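(* Let $\mathfrak{F}$ denote the set of all non-affine functions $f\in C[0,1]$. Then \[ 5\leq \limsup_{n\rightarrow \infty}\ \sup_{f\in \mathfrak{F}}\frac{\omega_2^{\varphi}\left(f;1/\sqrt{n}\right)}{\|B_nf-f\|}< 75 . \]
   Context: $C[0,1]$ is the space of real continuous functions on $[0,1]$ and $\|\cdot\|$ is the supremum norm on $[0,1]$. For $n\in\mathbb{N}=\{1,2,\ldots\}$, the $n$th Bernstein polynomial of $f:[0,1]\to\mathbb{R}$ is $B_nf(x)=\sum_{k=0}^n f(k/n)\binom{n}{k}x^k(1-x)^{n-k}$, $x\in[0,1]$. Let $\varphi(x)=\sqrt{x(1-x)}$, $0\le x\le 1$, and $\Delta_h^2f(x)=f(x+h)-2f(x)+f(x-h)$ for $h\ge 0$, $x\pm h\in[0,1]$. The Ditzian-Totik modulus of smoothness is, for $\delta\ge 0$, \[ \omega_{2}^{\varphi}(f;\delta )=\sup \left\{ \left| \Delta_{h\varphi (x)}^{2}f(x) \right| :\ 0\leq h\leq \delta,\ x\in[0,1],\ x\pm h\varphi (x)\in [0,1] \right\}. \] *)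

theory Defs
  imports "HOL-Analysis.Analysis"
begin

text \<open>Elements of \<open>C[0,1]\<close> are represented by functions \<open>real \<Rightarrow> real\<close> that are continuous on
  \<open>{0..1}\<close>. No definition below looks at values outside \<open>{0..1}\<close> when it is used as intended,
  and the real suprema are taken over nonempty bounded sets for such functions.\<close>

definition bernstein_op :: "nat \<Rightarrow> (real \<Rightarrow> real) \<Rightarrow> real \<Rightarrow> real" where
  "bernstein_op n f x = (\<Sum>k\<le>n. f (real k / real n) * Bernstein n k x)"

definition sup_norm :: "(real \<Rightarrow> real) \<Rightarrow> real" where
  "sup_norm f = (SUP x\<in>{0..1}. \<bar>f x\<bar>)"

definition step_weight :: "real \<Rightarrow> real" where
  "step_weight x = sqrt (x * (1 - x))"

definition second_diff :: "real \<Rightarrow> (real \<Rightarrow> real) \<Rightarrow> real \<Rightarrow> real" where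
  "second_diff h f x = f (x + h) - 2 * f x + f (x - h)"

definition DT_modulus :: "(real \<Rightarrow> real) \<Rightarrow> real \<Rightarrow> real" where
  "DT_modulus f \<delta> = Sup {\<bar>second_diff (h * step_weight x) f x\<bar> | h x.
      0 \<le> h \<and> h \<le> \<delta> \<and> x \<in> {0..1} \<and>
      x + h * step_weight x \<in> {0..1} \<and> x - h * step_weight x \<in> {0..1}}"

definition affine_on_unit :: "(real \<Rightarrow> real) \<Rightarrow> bool" where
  "affine_on_unit f \<longleftrightarrow> (\<exists>a b. \<forall>x\<in>{0..1}. f x = a * x + b)"

definition nonaffine_functions :: "(real \<Rightarrow> real) set" where
  "nonaffine_functions = {f. continuous_on {0..1} f \<and> \<not> affine_on_unit f}"

text \<open>For \<open>n \<ge> 1\<close> and nonaffine \<open>f\<close> the norm of \<open>B\<^sub>n f - f\<close> is positive, as \<open>B\<^sub>n f = f\<close> on \<open>[0,1]\<close>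
  forces \<open>f\<close> to be affine. So quotients by this norm are meaningful. Suprema of
  such quotients over all \<open>f\<close> are to be taken in \<open>ereal\<close>, where they always exist.\<close>

end

theory Submission
  imports Defs
begin

text \<open>Upper bound. Put \<open>\<epsilon> = \<parallel>B\<^sub>nf - f\<parallel>\<close>, \<open>\<rho> = B\<^sub>n(f - B\<^sub>nf)\<close> and \<open>g = B\<^sub>nf\<close>, so that
  \<open>g = \<Sum>\<^bsub>j<J\<^esub> B\<^sub>n\<^sup>j \<rho> + B\<^sub>n\<^sup>J g\<close>. If \<open>P\<close> is a polynomial of degree \<open>m\<close> whose Bernstein coefficients
  are bounded by \<open>C\<close>, then orthogonality of the Krawtchouk polynomials gives
  \<open>\<phi>\<^sup>3 \<bar>P'''\<bar> \<le> C (6 m(m-1)(m-2))\<^bsup>1/2\<^esup>\<close>; and \<open>B\<^sub>nP\<close> is an average of such polynomials whose degrees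
  are the numbers of occupied boxes when \<open>m\<close> balls are thrown into \<open>n\<close> boxes. Under iteration (this
  is the ancestral process of the Wright--Fisher model) the degrees decrease fast enough for the third
  derivatives to be summable, and \<open>\<phi>\<^sup>3 \<bar>g'''\<bar> \<le> 6 \<surd>6 n\<^bsup>3/2\<^esup> \<epsilon>\<close>. As \<open>\<parallel>B\<^sub>ng - g\<parallel> \<le> \<epsilon>\<close>, a Voronovskaya
  expansion of \<open>B\<^sub>ng - g\<close> yields \<open>\<phi>\<^sup>2 \<bar>g''\<bar> \<le> (2 + 12 \<surd>6 + o(1)) n \<epsilon>\<close>. The second differences of
  \<open>f - g\<close> are at most \<open>4\<epsilon>\<close>, and those of \<open>g\<close> at most \<open>2 (2 + 12 \<surd>6 + o(1)) \<epsilon>\<close>; the total is below \<open>70 \<epsilon>\<close>.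

  Lower bound. An oscillation that vanishes at the nodes is invisible to \<open>B\<^sub>n\<close> and contributes about
  \<open>4\<epsilon>\<close> to a second difference; adding \<open>4nx\<^sup>2\<close> gives about \<open>2\<epsilon>\<close> more without increasing the error.\<close>

section \<open>Bernstein forms\<close>

text \<open>The expectation of \<open>c\<close> at a binomial variable with parameters
  \<open>m\<close> and \<open>x\<close>. The coefficients are arbitrary because iterating the
  Bernstein operator produces forms of varying degree whose coefficients are known only through a
  bound.\<close>

definition bern :: "nat \<Rightarrow> (nat \<Rightarrow> real) \<Rightarrow> real \<Rightarrow> real" where
  "bern m c x = (\<Sum>i\<le>m. c i * Bernstein m i x)"

lemma bern_0 [simp]: "bern 0 c x = c 0"
  by (simp add: bern_def Bernstein_def)

lemma Bernstein_Suc_0: "Bernstein (Suc m) 0 x = (1 - x) * Bernstein m 0 x"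
  by (simp add: Bernstein_def)

lemma Bernstein_eq_0: "m < i \<Longrightarrow> Bernstein m i x = 0"
  by (simp add: Bernstein_def)

lemma Bernstein_Suc_Suc:
  "Bernstein (Suc m) (Suc i) x = x * Bernstein m i x + (1 - x) * Bernstein m (Suc i) x"
proof (cases "i < m")
  case True
  then have "m - i = Suc (m - Suc i)" by simp
  then show ?thesis by (simp add: Bernstein_def algebra_simps)
next
  case False
  then show ?thesis by (simp add: Bernstein_def algebra_simps not_less)
qed

text \<open>Conditions on the outcome of one of the \<open>Suc m\<close> trials.\<close>

lemma bern_Suc: "bern (Suc m) c x = x * bern m (\<lambda>i. c (Suc i)) x + (1 - x) * bern m c x"
proof -
  have "bern (Suc m) c x = c 0 * Bernstein (Suc m) 0 x + (\<Sum>i\<le>m. c (Suc i) * Bernstein (Suc m) (Suc i) x)"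
    unfolding bern_def by (rule sum.atMost_Suc_shift)
  also have "(\<Sum>i\<le>m. c (Suc i) * Bernstein (Suc m) (Suc i) x)
     = x * bern m (\<lambda>i. c (Suc i)) x + (1 - x) * (\<Sum>i\<le>m. c (Suc i) * Bernstein m (Suc i) x)"
    by (simp add: bern_def Bernstein_Suc_Suc sum_distrib_left algebra_simps flip: sum.distrib)
  finally have *: "bern (Suc m) c x = x * bern m (\<lambda>i. c (Suc i)) x
      + (1 - x) * (c 0 * Bernstein m 0 x + (\<Sum>i\<le>m. c (Suc i) * Bernstein m (Suc i) x))"
    by (simp add: Bernstein_Suc_0 algebra_simps)
  have "c 0 * Bernstein m 0 x + (\<Sum>i\<le>m. c (Suc i) * Bernstein m (Suc i) x)
      = (\<Sum>i\<le>Suc m. c i * Bernstein m i x)"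
    by (rule sum.atMost_Suc_shift[symmetric])
  also have "\<dots> = bern m c x"
    by (simp add: bern_def Bernstein_eq_0)
  finally show ?thesis using * by simp
qed

lemma bern_abs_le:
  assumes "x \<in> {0..1}" "\<And>i. i \<le> m \<Longrightarrow> \<bar>c i\<bar> \<le> C"
  shows "\<bar>bern m c x\<bar> \<le> C"
proof -
  have "\<bar>bern m c x\<bar> \<le> (\<Sum>i\<le>m. C * Bernstein m i x)"
    unfolding bern_def using assms
    by (intro order_trans[OF sum_abs] sum_mono) (auto simp: abs_mult Bernstein_nonneg intro!: mult_right_mono)
  then show ?thesis by (simp flip: sum_distrib_left)
qed

definition bpoly :: "nat \<Rightarrow> (nat \<Rightarrow> real) \<Rightarrow> real poly" where
  "bpoly m c = (\<Sum>i\<le>m. smult (c i * real (m choose i)) ([:0, 1:] ^ i * [:1, -1:] ^ (m - i)))"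

lemma poly_bpoly: "poly (bpoly m c) x = bern m c x"
  by (simp add: bpoly_def bern_def Bernstein_def poly_sum algebra_simps)

lemma bern_diff: "bern m (\<lambda>i. c i - d i) x = bern m c x - bern m d x"
  by (simp add: bern_def algebra_simps sum_subtractf)

lemma poly_eqI_real: "(\<And>x::real. poly p x = poly q x) \<Longrightarrow> p = q"
  by (metis poly_eq_poly_eq_iff ext)

section \<open>Third derivatives of Bernstein forms by Krawtchouk orthogonality\<close>

abbreviation deriv3 :: "real poly \<Rightarrow> real poly" where
  "deriv3 p \<equiv> (pderiv ^^ 3) p"

text \<open>The generating function \<open>(1 + t/x)\<^sup>i (1 - t/(1-x))\<^bsup>m-i\<^esup>\<close> of the Krawtchouk polynomials.\<close>

definition kraw_gen :: "nat \<Rightarrow> real \<Rightarrow> nat \<Rightarrow> real poly" where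
  "kraw_gen m x i = [:1, 1 / x:] ^ i * [:1, - 1 / (1 - x):] ^ (m - i)"

text \<open>Writing \<open>x + t = x (1 + t/x)\<close> and
  \<open>1 - (x + t) = (1 - x) (1 - t/(1 - x))\<close> splits the weight at \<open>x\<close> off
  each basis polynomial. The Taylor coefficients at \<open>x\<close> thus become binomial means of
  \<open>c\<close> against Krawtchouk polynomials.\<close>

lemma pcompose_shift_bpoly:
  assumes "0 < x" "x < 1"
  shows "pcompose (bpoly m c) [:x, 1:] = (\<Sum>i\<le>m. smult (c i * Bernstein m i x) (kraw_gen m x i))"
proof (rule poly_eqI_real)
  fix t :: real
  have 1: "x + t = x * (1 + t / x)" "1 - (x + t) = (1 - x) * (1 + t * (- 1 / (1 - x)))"
    using assms by (simp_all add: field_simps)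
  have "Bernstein m i (x + t) = Bernstein m i x * poly (kraw_gen m x i) t" for i
    unfolding Bernstein_def kraw_gen_def 1(2) unfolding 1(1)
    by (simp add: power_mult_distrib)
  then show "poly (pcompose (bpoly m c) [:x, 1:]) t
      = poly (\<Sum>i\<le>m. smult (c i * Bernstein m i x) (kraw_gen m x i)) t"
    by (simp add: poly_pcompose poly_bpoly poly_sum bern_def mult.assoc)
qed

text \<open>The binomial theorem sums the products; in \<open>?u + ?v\<close> the terms linear in
  \<open>s\<close> or \<open>t\<close> alone cancel. That only the product \<open>s t\<close>
  survives is the orthogonality of Krawtchouk polynomials of different degrees.\<close>

lemma kraw_gen_product_sum:
  assumes "0 < x" "x < 1"
  shows "(\<Sum>i\<le>m. smult (Bernstein m i x * poly (kraw_gen m x i) s) (kraw_gen m x i))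
       = [:1, s / (x * (1 - x)):] ^ m"
proof (rule poly_eqI_real)
  fix t :: real
  let ?u = "x * ((1 + s / x) * (1 + t / x))"
  let ?v = "(1 - x) * ((1 - s / (1 - x)) * (1 - t / (1 - x)))"
  have "poly (\<Sum>i\<le>m. smult (Bernstein m i x * poly (kraw_gen m x i) s) (kraw_gen m x i)) t
      = (\<Sum>i\<le>m. real (m choose i) * ?u ^ i * ?v ^ (m - i))"
    by (simp add: poly_sum Bernstein_def kraw_gen_def power_mult_distrib mult_ac)
  also have "\<dots> = (?u + ?v) ^ m"
    by (rule binomial_ring[symmetric])
  also have "?u + ?v = 1 + s * t / (x * (1 - x))"
    using assms by (simp add: divide_simps) (simp add: algebra_simps)
  finally show "poly (\<Sum>i\<le>m. smult (Bernstein m i x * poly (kraw_gen m x i) s) (kraw_gen m x i)) t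
      = poly ([:1, s / (x * (1 - x)):] ^ m) t"
    by (simp add: mult_ac)
qed

text \<open>Compares the coefficients of \<open>t^k\<close>, and then of \<open>s^k\<close>, in
  \<open>kraw_gen_product_sum\<close>.\<close>

lemma kraw_gen_parseval:
  assumes "0 < x" "x < 1"
  shows "(\<Sum>i\<le>m. Bernstein m i x * (coeff (kraw_gen m x i) k)\<^sup>2) = real (m choose k) / (x * (1 - x)) ^ k"
proof -
  define \<kappa> where "\<kappa> i = coeff (kraw_gen m x i) k" for i
  have "(\<Sum>i\<le>m. smult (Bernstein m i x * \<kappa> i) (kraw_gen m x i))
      = monom (real (m choose k) / (x * (1 - x)) ^ k) k"
  proof (rule poly_eqI_real)
    fix s :: real
    have "poly (\<Sum>i\<le>m. smult (Bernstein m i x * \<kappa> i) (kraw_gen m x i)) s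
       = coeff (\<Sum>i\<le>m. smult (Bernstein m i x * poly (kraw_gen m x i) s) (kraw_gen m x i)) k"
      by (simp add: poly_sum coeff_sum \<kappa>_def mult_ac)
    also have "\<dots> = real (m choose k) * (s / (x * (1 - x))) ^ k"
      unfolding kraw_gen_product_sum[OF assms]
    proof (cases "k \<le> m")
      case False
      have "degree ([:1, s / (x * (1 - x)):] ^ m) \<le> degree [:1, s / (x * (1 - x)):] * m"
        by (rule degree_power_le)
      also have "\<dots> \<le> 1 * m"
        by (intro mult_le_mono1) simp
      finally have "degree ([:1, s / (x * (1 - x)):] ^ m) < k"
        using False by simp
      then show "coeff ([:1, s / (x * (1 - x)):] ^ m) k = real (m choose k) * (s / (x * (1 - x))) ^ k"
        using False by (simp add: coeff_eq_0)
    qed (simp add: coeff_linear_poly_power)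
    finally show "poly (\<Sum>i\<le>m. smult (Bernstein m i x * \<kappa> i) (kraw_gen m x i)) s
       = poly (monom (real (m choose k) / (x * (1 - x)) ^ k) k) s"
      by (simp add: poly_monom power_divide)
  qed
  then have "coeff (\<Sum>i\<le>m. smult (Bernstein m i x * \<kappa> i) (kraw_gen m x i)) k
       = real (m choose k) / (x * (1 - x)) ^ k"
    by simp
  then show ?thesis
    by (simp add: coeff_sum \<kappa>_def power2_eq_square mult_ac)
qed

lemma coeff3_pcompose_shift: "poly (deriv3 p) x = 6 * coeff (pcompose p [:x, 1:]) 3"
proof -
  have "pderiv (pcompose q [:x, 1:]) = pcompose (pderiv q) [:x, 1:]" for q :: "real poly"
    by (simp add: pderiv_pcompose pderiv_pCons)
  then have "pcompose (deriv3 p) [:x, 1:] = deriv3 (pcompose p [:x, 1:])"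
    by (simp add: numeral_3_eq_3)
  then have "poly (deriv3 p) x = coeff (deriv3 (pcompose p [:x, 1:])) 0"
    by (metis (no_types) add.right_neutral mult_zero_left poly_0_coeff_0 poly_pCons poly_pcompose poly_0)
  then show ?thesis
    by (simp add: numeral_3_eq_3 coeff_pderiv)
qed

text \<open>Cauchy-Schwarz after splitting each weight as
  \<open>sqrt (w i) * sqrt (w i)\<close>.\<close>

lemma sum_mult_abs_le_sqrt:
  fixes w k :: "'a \<Rightarrow> real"
  assumes "finite A" "\<And>i. i \<in> A \<Longrightarrow> 0 \<le> w i" "sum w A = 1"
  shows "(\<Sum>i\<in>A. w i * \<bar>k i\<bar>) \<le> sqrt (\<Sum>i\<in>A. w i * (k i)\<^sup>2)"
proof (rule real_le_rsqrt)
  have "(\<Sum>i\<in>A. w i * \<bar>k i\<bar>) = (\<Sum>i\<in>A. sqrt (w i) * (sqrt (w i) * \<bar>k i\<bar>))"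
    by (intro sum.cong) (auto simp: assms(2) simp flip: mult.assoc)
  also have "\<dots>\<^sup>2 \<le> (\<Sum>i\<in>A. (sqrt (w i))\<^sup>2) * (\<Sum>i\<in>A. (sqrt (w i) * \<bar>k i\<bar>)\<^sup>2)"
    by (rule Cauchy_Schwarz_ineq_sum)
  also have "\<dots> = (\<Sum>i\<in>A. w i) * (\<Sum>i\<in>A. w i * (k i)\<^sup>2)"
    by (intro arg_cong2[of _ _ _ _ "(*)"] sum.cong) (auto simp: assms(2) power_mult_distrib)
  finally show "(\<Sum>i\<in>A. w i * \<bar>k i\<bar>)\<^sup>2 \<le> (\<Sum>i\<in>A. w i * (k i)\<^sup>2)"
    using assms(3) by simp
qed

lemma choose_3_real: "real (m choose 3) = real m * (real m - 1) * (real m - 2) / 6"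
proof -
  have "(of_nat (m choose 3) :: real) = of_nat m gchoose 3"
    by (simp add: binomial_gbinomial)
  also have "\<dots> = real m * (real m - 1) * (real m - 2) / 6"
    by (simp add: gbinomial_prod_rev numeral_3_eq_3 fact_numeral algebra_simps)
  finally show ?thesis .
qed

text \<open>Bounds \<open>sqrt (6 m (m - 1) (m - 2))\<close> by replacing \<open>m - 2\<close> with
  \<open>m - 1\<close>; the result is exactly the decrease of the supersolution in
  \<open>sum_iter_weight_le\<close>. At \<open>m = 0\<close> the factor \<open>sqrt 0\<close> makes
  it vanish.\<close>

definition deriv3_weight :: "nat \<Rightarrow> real" where
  "deriv3_weight m = sqrt 6 * sqrt (real m) * (real m - 1)"

lemma deriv3_weight_nonneg: "0 \<le> deriv3_weight m"
  by (cases m) (auto simp: deriv3_weight_def)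

lemma choose_3_le_deriv3_weight: "6 * sqrt (real (m choose 3)) \<le> deriv3_weight m"
proof (cases m)
  case 0
  then show ?thesis by (simp add: deriv3_weight_def)
next
  case (Suc k)
  have "(6 * sqrt (real (m choose 3)))\<^sup>2 = 6 * (real m * ((real m - 1) * (real m - 2)))"
    by (simp only: power_mult_distrib real_sqrt_pow2[OF of_nat_0_le_iff]) (simp add: choose_3_real)
  also have "\<dots> \<le> 6 * (real m * ((real m - 1) * (real m - 1)))"
    using Suc by (intro mult_left_mono) auto
  also have "\<dots> = (deriv3_weight m)\<^sup>2"
    unfolding deriv3_weight_def power_mult_distrib by (simp add: power2_eq_square[of "real m - 1"])
  finally show ?thesis
    using deriv3_weight_nonneg power2_le_imp_le by blast
qed

lemma step_weight_pos: "0 < x \<Longrightarrow> x < 1 \<Longrightarrow> 0 < step_weight x"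
  by (simp add: step_weight_def)

lemma step_weight_sq: "0 \<le> x \<Longrightarrow> x \<le> 1 \<Longrightarrow> (step_weight x)\<^sup>2 = x * (1 - x)"
  by (simp add: step_weight_def)

lemma step_weight_pow6:
  assumes "0 < x" "x < 1"
  shows "(step_weight x ^ 3)\<^sup>2 = (x * (1 - x)) ^ 3"
proof -
  have "(step_weight x ^ 3)\<^sup>2 = ((step_weight x)\<^sup>2) ^ 3"
    by (simp flip: power_mult)
  then show ?thesis using assms by (simp add: step_weight_sq)
qed

text \<open>The third Taylor coefficient is a mean of \<open>c\<close> times a Krawtchouk
  coefficient. Bounding \<open>c\<close> by \<open>C\<close>, Cauchy-Schwarz and
  \<open>kraw_gen_parseval\<close> leave the square root of \<open>m choose 3\<close>.\<close>

lemma deriv3_bpoly_bound: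
  assumes x: "0 < x" "x < 1" and c: "\<And>i. i \<le> m \<Longrightarrow> \<bar>c i\<bar> \<le> C"
  shows "step_weight x ^ 3 * \<bar>poly (deriv3 (bpoly m c)) x\<bar> \<le> C * deriv3_weight m"
proof -
  let ?w = "\<lambda>i. Bernstein m i x" and ?k = "\<lambda>i. coeff (kraw_gen m x i) 3"
  have C: "0 \<le> C" using c[of 0] by simp
  have p: "0 < step_weight x" using x by (rule step_weight_pos)
  have "\<bar>coeff (pcompose (bpoly m c) [:x, 1:]) 3\<bar> = \<bar>\<Sum>i\<le>m. c i * ?w i * ?k i\<bar>"
    by (simp add: pcompose_shift_bpoly[OF x] coeff_sum)
  also have "\<dots> \<le> (\<Sum>i\<le>m. \<bar>c i\<bar> * ?w i * \<bar>?k i\<bar>)"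
    using x by (intro order_trans[OF sum_abs] sum_mono) (simp add: abs_mult Bernstein_nonneg)
  also have "\<dots> \<le> (\<Sum>i\<le>m. C * (?w i * \<bar>?k i\<bar>))"
    using x c by (intro sum_mono) (simp add: mult.assoc mult_right_mono Bernstein_nonneg)
  also have "\<dots> = C * (\<Sum>i\<le>m. ?w i * \<bar>?k i\<bar>)"
    by (simp add: sum_distrib_left)
  also have "\<dots> \<le> C * sqrt (\<Sum>i\<le>m. ?w i * (?k i)\<^sup>2)"
    using C x by (intro mult_left_mono sum_mult_abs_le_sqrt) (auto simp: Bernstein_nonneg)
  also have "(\<Sum>i\<le>m. ?w i * (?k i)\<^sup>2) = real (m choose 3) / (step_weight x ^ 3)\<^sup>2"
    by (simp only: kraw_gen_parseval[OF x] step_weight_pow6[OF x])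
  also have "sqrt \<dots> = sqrt (real (m choose 3)) / step_weight x ^ 3"
    unfolding real_sqrt_divide real_sqrt_abs using p by simp
  finally have "step_weight x ^ 3 * \<bar>coeff (pcompose (bpoly m c) [:x, 1:]) 3\<bar> \<le> C * sqrt (real (m choose 3))"
    using p by (simp add: field_simps)
  then have "step_weight x ^ 3 * \<bar>poly (deriv3 (bpoly m c)) x\<bar> \<le> C * (6 * sqrt (real (m choose 3)))"
    by (simp add: coeff3_pcompose_shift abs_mult)
  also have "\<dots> \<le> C * deriv3_weight m"
    using C choose_3_le_deriv3_weight by (rule mult_left_mono[rotated])
  finally show ?thesis .
qed

section \<open>Iterates of the Bernstein operator\<close>

text \<open>The expectation of \<open>G\<close> over a random subset of \<open>R\<close> that
  contains each element independently with probability \<open>x\<close>.\<close>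

definition cube_sum :: "'a set \<Rightarrow> ('a set \<Rightarrow> real) \<Rightarrow> real \<Rightarrow> real" where
  "cube_sum R G x = (\<Sum>\<eta>\<in>Pow R. x ^ card \<eta> * (1 - x) ^ card (R - \<eta>) * G \<eta>)"

lemma cube_sum_empty [simp]: "cube_sum {} G x = G {}"
  by (simp add: cube_sum_def)

lemma cube_sum_cong: "(\<And>\<eta>. \<eta> \<subseteq> R \<Longrightarrow> G \<eta> = H \<eta>) \<Longrightarrow> cube_sum R G x = cube_sum R H x"
  by (simp add: cube_sum_def)

lemma cube_sum_insert:
  assumes "finite R" "b \<notin> R"
  shows "cube_sum (insert b R) G x = x * cube_sum R (\<lambda>\<eta>. G (insert b \<eta>)) x + (1 - x) * cube_sum R G x"
proof -
  have inj: "inj_on (insert b) (Pow R)"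
    using assms(2) by (auto simp: inj_on_def)
  have disj: "Pow R \<inter> insert b ` Pow R = {}"
    using assms(2) by auto
  have 1: "x ^ card \<eta> * (1 - x) ^ card (insert b R - \<eta>) * G \<eta>
      = (1 - x) * (x ^ card \<eta> * (1 - x) ^ card (R - \<eta>) * G \<eta>)" if "\<eta> \<in> Pow R" for \<eta>
  proof -
    have "insert b R - \<eta> = insert b (R - \<eta>)" using that assms by auto
    then show ?thesis using assms by simp
  qed
  have 2: "x ^ card (insert b \<eta>) * (1 - x) ^ card (insert b R - insert b \<eta>) * G (insert b \<eta>)
      = x * (x ^ card \<eta> * (1 - x) ^ card (R - \<eta>) * G (insert b \<eta>))" if "\<eta> \<in> Pow R" for \<eta>
  proof -
    have "insert b R - insert b \<eta> = R - \<eta>" "finite \<eta>" "b \<notin> \<eta>"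
      using that assms by (auto intro: finite_subset)
    then show ?thesis by simp
  qed
  let ?F = "\<lambda>\<eta>. x ^ card \<eta> * (1 - x) ^ card (insert b R - \<eta>) * G \<eta>"
  have "cube_sum (insert b R) G x = sum ?F (Pow R) + sum ?F (insert b ` Pow R)"
    unfolding cube_sum_def Pow_insert using assms(1) disj by (intro sum.union_disjoint) auto
  also have "sum ?F (Pow R) = (1 - x) * cube_sum R G x"
    unfolding cube_sum_def sum_distrib_left by (intro sum.cong refl 1)
  also have "sum ?F (insert b ` Pow R) = x * cube_sum R (\<lambda>\<eta>. G (insert b \<eta>)) x"
    unfolding cube_sum_def sum_distrib_left sum.reindex[OF inj] o_def by (intro sum.cong refl 2)
  finally show ?thesis by simp
qed

lemma cube_sum_sum: "cube_sum R (\<lambda>\<eta>. \<Sum>l\<in>A. G l \<eta>) x = (\<Sum>l\<in>A. cube_sum R (G l) x)"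
  unfolding cube_sum_def sum_distrib_left by (rule sum.swap)

lemma cube_sum_mult: "cube_sum R (\<lambda>\<eta>. a * G \<eta>) x = a * cube_sum R G x"
  by (simp add: cube_sum_def sum_distrib_left mult_ac)

lemma cube_sum_card:
  assumes "finite R"
  shows "cube_sum R (\<lambda>\<eta>. c (card \<eta>)) x = bern (card R) c x"
  using assms
proof (induction R arbitrary: c)
  case (insert b R)
  have "cube_sum R (\<lambda>\<eta>. c (card (insert b \<eta>))) x = cube_sum R (\<lambda>\<eta>. c (Suc (card \<eta>))) x"
    using insert.hyps by (intro cube_sum_cong) (metis card_insert_disjoint finite_subset subsetD)
  with insert show ?case
    by (simp add: cube_sum_insert bern_Suc insert.IH[of "\<lambda>i. c (Suc i)"])
qed simp

text \<open>Each element outside \<open>R\<close> only contributes the factor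
  \<open>x + (1 - x) = 1\<close>.\<close>

lemma cube_sum_restrict:
  assumes "finite N" "R \<subseteq> N"
  shows "cube_sum N (\<lambda>\<eta>. G (\<eta> \<inter> R)) x = cube_sum R G x"
proof -
  have "finite S \<Longrightarrow> S \<inter> R = {} \<Longrightarrow> cube_sum (S \<union> R) (\<lambda>\<eta>. G (\<eta> \<inter> R)) x = cube_sum R G x" for S
  proof (induction S rule: finite_induct)
    case empty
    show ?case by (simp, rule cube_sum_cong) (simp add: inf_absorb1)
  next
    case (insert b S)
    have "finite (S \<union> R)" "b \<notin> S \<union> R"
      using insert.hyps insert.prems assms finite_subset by auto
    moreover have "insert b \<eta> \<inter> R = \<eta> \<inter> R" for \<eta>
      using insert.prems by auto
    ultimately show ?case
      using insert by (simp add: cube_sum_insert algebra_simps)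
  qed
  from this[of "N - R"] assms show ?thesis
    by (simp add: Un_absorb2 Diff_partition Int_commute finite_Diff)
qed

lemma Bernstein_raise:
  assumes "i \<le> m"
  shows "(1 - x) * Bernstein m i x = (real (Suc m) - real i) / real (Suc m) * Bernstein (Suc m) i x"
    and "x * Bernstein m i x = real (Suc i) / real (Suc m) * Bernstein (Suc m) (Suc i) x"
proof -
  have "Suc m * (m choose i) = (Suc m - i) * (Suc m choose i)"
    using binomial_absorb_comp[of "Suc m" i] by simp
  then have "real (Suc m) * real (m choose i) = (real (Suc m) - real i) * real (Suc m choose i)"
    using assms by (metis (no_types) of_nat_mult of_nat_diff le_SucI)
  then have 1: "real (m choose i) = (real (Suc m) - real i) / real (Suc m) * real (Suc m choose i)"
    by (simp add: field_simps)
  have "Suc m - i = Suc (m - i)" using assms by simp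
  then show "(1 - x) * Bernstein m i x = (real (Suc m) - real i) / real (Suc m) * Bernstein (Suc m) i x"
    unfolding Bernstein_def by (subst 1) simp
  have "real (Suc i) * real (Suc m choose Suc i) = real (Suc m) * real (m choose i)"
    using Suc_times_binomial_eq[of m i] by (metis of_nat_mult mult.commute)
  then have 2: "real (m choose i) = real (Suc i) / real (Suc m) * real (Suc m choose Suc i)"
    by (simp add: field_simps)
  show "x * Bernstein m i x = real (Suc i) / real (Suc m) * Bernstein (Suc m) (Suc i) x"
    unfolding Bernstein_def by (subst 2) simp
qed

text \<open>Degree elevation. The new coefficients are convex combinations of the old ones, so a
  common bound survives. At \<open>i = 0\<close>, where \<open>i - 1\<close> truncates, and at
  \<open>i = Suc m\<close>, where \<open>d\<close> is read beyond \<open>m\<close>, the weight is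
  \<open>0\<close>.\<close>

lemma bern_raise:
  "x * bern m c x + (1 - x) * bern m d x
   = bern (Suc m) (\<lambda>i. (real i * c (i - 1) + (real (Suc m) - real i) * d i) / real (Suc m)) x"
proof -
  define B where "B i = Bernstein (Suc m) i x / real (Suc m)" for i
  have "x * bern m c x = (\<Sum>i\<le>m. c i * (x * Bernstein m i x))"
    by (simp add: bern_def sum_distrib_left mult_ac)
  also have "\<dots> = (\<Sum>i\<le>m. real (Suc i) * c i * B (Suc i))"
    by (intro sum.cong) (simp_all add: Bernstein_raise(2) B_def mult_ac)
  also have "\<dots> = (\<Sum>i\<le>Suc m. real i * c (i - 1) * B i)"
    by (subst sum.atMost_Suc_shift) simp
  finally have 1: "x * bern m c x = \<dots>" .
  have "(1 - x) * bern m d x = (\<Sum>i\<le>m. d i * ((1 - x) * Bernstein m i x))"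
    by (simp add: bern_def sum_distrib_left mult_ac)
  also have "\<dots> = (\<Sum>i\<le>m. (real (Suc m) - real i) * d i * B i)"
    by (intro sum.cong) (simp_all add: Bernstein_raise(1) B_def mult_ac)
  also have "\<dots> = (\<Sum>i\<le>Suc m. (real (Suc m) - real i) * d i * B i)"
    by simp
  finally have 2: "(1 - x) * bern m d x = \<dots>" .
  show ?thesis
    unfolding 1 2 unfolding bern_def B_def
    by (simp add: add_divide_distrib ring_distribs flip: sum.distrib del: sum.atMost_Suc)
qed

text \<open>In effect \<open>c i\<close> is the average of \<open>G\<close> over the subsets of size
  \<open>i\<close>. The induction conditions on one element and merges the two forms by
  \<open>bern_raise\<close>.\<close>

lemma cube_sum_eq_bern:
  assumes "finite R" "\<And>\<eta>. \<bar>G \<eta>\<bar> \<le> C"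
  obtains c where "\<And>x. cube_sum R G x = bern (card R) c x" "\<And>i. i \<le> card R \<Longrightarrow> \<bar>c i\<bar> \<le> C"
proof -
  have "\<exists>c. (\<forall>x. cube_sum R G x = bern (card R) c x) \<and> (\<forall>i\<le>card R. \<bar>c i\<bar> \<le> C)"
    using assms
  proof (induction R arbitrary: G)
    case empty
    then show ?case by (intro exI[of _ "\<lambda>_. G {}"]) auto
  next
    case (insert b R)
    let ?m = "card R"
    obtain c where c: "\<And>x. cube_sum R (\<lambda>\<eta>. G (insert b \<eta>)) x = bern ?m c x" "\<And>i. i \<le> ?m \<Longrightarrow> \<bar>c i\<bar> \<le> C"
      using insert.IH[of "\<lambda>\<eta>. G (insert b \<eta>)"] insert.prems by blast
    obtain d where d: "\<And>x. cube_sum R G x = bern ?m d x" "\<And>i. i \<le> ?m \<Longrightarrow> \<bar>d i\<bar> \<le> C"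
      using insert.IH[of G] insert.prems by blast
    have C: "0 \<le> C" using insert.prems[of "{}"] by simp
    let ?e = "\<lambda>i. (real i * c (i - 1) + (real (Suc ?m) - real i) * d i) / real (Suc ?m)"
    have "\<bar>?e i\<bar> \<le> C" if "i \<le> Suc ?m" for i
    proof -
      have "\<bar>real i * c (i - 1)\<bar> \<le> real i * C"
        using c(2)[of "i - 1"] that by (cases i) (auto simp: abs_mult intro!: mult_left_mono)
      moreover have "\<bar>(real (Suc ?m) - real i) * d i\<bar> \<le> (real (Suc ?m) - real i) * C"
      proof (cases "i = Suc ?m")
        case False
        then show ?thesis using d(2)[of i] that unfolding abs_mult by (intro mult_mono) auto
      qed simp
      ultimately have "\<bar>real i * c (i - 1) + (real (Suc ?m) - real i) * d i\<bar> \<le> real (Suc ?m) * C"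
        by (simp add: algebra_simps)
      then show ?thesis by (simp add: field_simps)
    qed
    then show ?case
      using insert.hyps by (intro exI[of _ ?e]) (simp add: cube_sum_insert c(1) d(1) bern_raise)
  qed
  then show thesis using that by blast
qed

section \<open>Balls in boxes and one application of the Bernstein operator\<close>

definition words :: "nat \<Rightarrow> nat \<Rightarrow> nat list set" where
  "words n m = {l. set l \<subseteq> {..<n} \<and> length l = m}"

lemma finite_words [simp]: "finite (words n m)"
  by (simp add: words_def finite_lists_length_eq)

lemma card_words [simp]: "card (words n m) = n ^ m"
  by (simp add: words_def card_lists_length_eq)

lemma words_0 [simp]: "words n 0 = {[]}"
  by (auto simp: words_def)

lemma sum_words_Suc: "(\<Sum>l\<in>words n (Suc m). F l) = (\<Sum>b<n. \<Sum>l\<in>words n m. F (b # l))"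
proof -
  have "words n (Suc m) = (\<lambda>(b, l). b # l) ` ({..<n} \<times> words n m)"
    by (auto simp: words_def image_iff length_Suc_conv)
  moreover have "inj_on (\<lambda>(b, l). b # l) ({..<n} \<times> words n m)"
    by (auto simp: inj_on_def)
  ultimately show ?thesis
    by (simp add: sum.reindex sum.cartesian_product split_def)
qed

lemma sum_lessThan_if_mem:
  fixes u v :: real
  assumes "\<xi> \<subseteq> {..<n}"
  shows "(\<Sum>b<n. if b \<in> \<xi> then u else v) = real (card \<xi>) * u + (real n - real (card \<xi>)) * v"
proof -
  have "card ({..<n} - \<xi>) = n - card \<xi>"
    using assms by (subst card_Diff_subset) (auto intro: finite_subset)
  moreover have "card \<xi> \<le> n"
    using card_mono[OF _ assms] by simp
  ultimately show ?thesis
    using assms by (simp add: sum.If_cases inf_absorb2 Diff_eq[symmetric] of_nat_diff)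
qed

text \<open>Throwing \<open>m\<close> balls into \<open>n\<close> boxes, of which those in \<open>\<xi>\<close> are marked.\<close>

lemma bern_card_div:
  assumes "\<xi> \<subseteq> {..<n}" "0 < n"
  shows "real n ^ m * bern m c (real (card \<xi>) / real n)
     = (\<Sum>l\<in>words n m. c (length (filter (\<lambda>b. b \<in> \<xi>) l)))"
proof (induction m arbitrary: c)
  case (Suc m)
  let ?k = "real (card \<xi>)"
  have "(\<Sum>l\<in>words n (Suc m). c (length (filter (\<lambda>b. b \<in> \<xi>) l)))
     = (\<Sum>b<n. if b \<in> \<xi> then \<Sum>l\<in>words n m. c (Suc (length (filter (\<lambda>b. b \<in> \<xi>) l)))
                else \<Sum>l\<in>words n m. c (length (filter (\<lambda>b. b \<in> \<xi>) l)))"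
    unfolding sum_words_Suc by (intro sum.cong) auto
  also have "\<dots> = ?k * (real n ^ m * bern m (\<lambda>i. c (Suc i)) (?k / real n))
      + (real n - ?k) * (real n ^ m * bern m c (?k / real n))"
    by (simp only: sum_lessThan_if_mem[OF assms(1)] Suc.IH[of c] Suc.IH[of "\<lambda>i. c (Suc i)"])
  also have "\<dots> = real n ^ Suc m * bern (Suc m) c (?k / real n)"
    using assms(2) by (simp add: bern_Suc field_simps)
  finally show ?case by simp
qed simp

definition bernstein_poly :: "nat \<Rightarrow> real poly \<Rightarrow> real poly" where
  "bernstein_poly n p = bpoly n (\<lambda>k. poly p (real k / real n))"

lemma bernstein_poly_smult: "bernstein_poly n (smult a p) = smult a (bernstein_poly n p)"
  by (rule poly_eqI_real) (simp add: bernstein_poly_def poly_bpoly bern_def sum_distrib_left mult_ac)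

lemma bernstein_poly_add: "bernstein_poly n (p + q) = bernstein_poly n p + bernstein_poly n q"
  by (rule poly_eqI_real) (simp add: bernstein_poly_def poly_bpoly bern_def sum.distrib ring_distribs)

lemma bernstein_poly_0: "bernstein_poly n 0 = 0"
  using bernstein_poly_smult[of n 0 0] by simp

lemma bernstein_poly_sum: "bernstein_poly n (\<Sum>l\<in>A. F l) = (\<Sum>l\<in>A. bernstein_poly n (F l))"
  by (induction A rule: infinite_finite_induct) (simp_all add: bernstein_poly_0 bernstein_poly_add)

lemma bernstein_poly_pow_smult: "(bernstein_poly n ^^ j) (smult a p) = smult a ((bernstein_poly n ^^ j) p)"
  by (induction j) (simp_all add: bernstein_poly_smult)

lemma bernstein_poly_pow_add: "(bernstein_poly n ^^ j) (p + q) = (bernstein_poly n ^^ j) p + (bernstein_poly n ^^ j) q"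
  by (induction j) (simp_all add: bernstein_poly_add)

lemma bernstein_poly_pow_sum: "(bernstein_poly n ^^ j) (\<Sum>l\<in>A. F l) = (\<Sum>l\<in>A. (bernstein_poly n ^^ j) (F l))"
  by (induction j) (simp_all add: bernstein_poly_sum)

text \<open>Exchanges two averages: over a random set of marked boxes, which is the Bernstein
  operator, and over throws \<open>l\<close> of \<open>m\<close> balls, which evaluate
  \<open>bern m c\<close> at the marked fraction. For a fixed throw only the occupied boxes matter,
  so the degree becomes \<open>card (set l)\<close>.\<close>

lemma bernstein_poly_bpoly:
  assumes n: "0 < n" and c: "\<And>i. i \<le> m \<Longrightarrow> \<bar>c i\<bar> \<le> C"
  obtains d where "bernstein_poly n (bpoly m c) = smult (1 / real n ^ m) (\<Sum>l\<in>words n m. bpoly (card (set l)) (d l))"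
    and "\<And>l i. l \<in> words n m \<Longrightarrow> i \<le> card (set l) \<Longrightarrow> \<bar>d l i\<bar> \<le> C"
proof -
  define G where "G l \<eta> = c (length (filter (\<lambda>b. b \<in> \<eta>) l))" for l :: "nat list" and \<eta>
  have "\<exists>d. (\<forall>x. cube_sum (set l) (G l) x = bern (card (set l)) d x) \<and> (\<forall>i\<le>card (set l). \<bar>d i\<bar> \<le> C)"
    if "l \<in> words n m" for l
  proof -
    have *: "\<And>\<eta>. \<bar>G l \<eta>\<bar> \<le> C"
      unfolding G_def using that length_filter_le[of _ l] by (intro c) (auto simp: words_def)
    obtain d where "\<And>x. cube_sum (set l) (G l) x = bern (card (set l)) d x"
        "\<And>i. i \<le> card (set l) \<Longrightarrow> \<bar>d i\<bar> \<le> C"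
      using cube_sum_eq_bern[of "set l" "G l", OF finite_set *] by blast
    then show ?thesis by blast
  qed
  then obtain d where d: "\<And>l x. l \<in> words n m \<Longrightarrow> cube_sum (set l) (G l) x = bern (card (set l)) (d l) x"
      "\<And>l i. l \<in> words n m \<Longrightarrow> i \<le> card (set l) \<Longrightarrow> \<bar>d l i\<bar> \<le> C"
    by metis
  have "bernstein_poly n (bpoly m c) = smult (1 / real n ^ m) (\<Sum>l\<in>words n m. bpoly (card (set l)) (d l))"
  proof (rule poly_eqI_real)
    fix x
    have G_Int: "G l (\<eta> \<inter> set l) = G l \<eta>" for l \<eta>
      unfolding G_def by (intro arg_cong[of _ _ "\<lambda>l. c (length l)"] filter_cong) auto
    have "poly (bernstein_poly n (bpoly m c)) x = cube_sum {..<n} (\<lambda>\<xi>. bern m c (real (card \<xi>) / real n)) x"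
      using cube_sum_card[of "{..<n}" "\<lambda>k. bern m c (real k / real n)" x]
      by (simp add: bernstein_poly_def poly_bpoly)
    also have "\<dots> = cube_sum {..<n} (\<lambda>\<xi>. 1 / real n ^ m * (\<Sum>l\<in>words n m. G l (\<xi> \<inter> set l))) x"
      using bern_card_div[of _ n m c] n
      by (intro cube_sum_cong) (simp add: G_Int, simp add: G_def field_simps)
    also have "\<dots> = 1 / real n ^ m * (\<Sum>l\<in>words n m. cube_sum {..<n} (\<lambda>\<xi>. G l (\<xi> \<inter> set l)) x)"
      by (simp only: cube_sum_sum cube_sum_mult)
    also have "\<dots> = 1 / real n ^ m * (\<Sum>l\<in>words n m. bern (card (set l)) (d l) x)"
      by (intro arg_cong2[of _ _ _ _ "(*)"] sum.cong refl)
        (auto simp: d(1)[symmetric] words_def intro!: cube_sum_restrict)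
    finally show "poly (bernstein_poly n (bpoly m c)) x
        = poly (smult (1 / real n ^ m) (\<Sum>l\<in>words n m. bpoly (card (set l)) (d l))) x"
      by (simp add: poly_sum poly_bpoly)
  qed
  then show thesis using d(2) that by blast
qed

section \<open>The ancestral process and the summability of the third derivatives\<close>

text \<open>\<open>iter_weight n j m\<close> is the expectation of \<open>deriv3_weight\<close> of the number of ancestors, \<open>j\<close> generations back,
  of \<open>m\<close> individuals in a Wright--Fisher population of size \<open>n\<close>.\<close>

primrec iter_weight :: "nat \<Rightarrow> nat \<Rightarrow> nat \<Rightarrow> real" where
  "iter_weight n 0 m = deriv3_weight m"
| "iter_weight n (Suc j) m = (\<Sum>l\<in>words n m. iter_weight n j (card (set l))) / real n ^ m"

lemma iter_weight_nonneg: "0 \<le> iter_weight n j m"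
  by (induction j arbitrary: m) (auto simp: deriv3_weight_nonneg intro!: divide_nonneg_nonneg sum_nonneg)

lemma deriv3_iterate_bound:
  assumes n: "0 < n" and x: "0 < x" "x < 1" and c: "\<And>i. i \<le> m \<Longrightarrow> \<bar>c i\<bar> \<le> C"
  shows "step_weight x ^ 3 * \<bar>poly (deriv3 ((bernstein_poly n ^^ j) (bpoly m c))) x\<bar> \<le> C * iter_weight n j m"
  using c
proof (induction j arbitrary: m c)
  case 0
  then show ?case using deriv3_bpoly_bound[OF x] by simp
next
  case (Suc j)
  obtain d where d: "bernstein_poly n (bpoly m c) = smult (1 / real n ^ m) (\<Sum>l\<in>words n m. bpoly (card (set l)) (d l))"
    and d_le: "\<And>l i. l \<in> words n m \<Longrightarrow> i \<le> card (set l) \<Longrightarrow> \<bar>d l i\<bar> \<le> C"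
    using bernstein_poly_bpoly[OF n, of m c C] Suc.prems by blast
  define D where "D l = poly (deriv3 ((bernstein_poly n ^^ j) (bpoly (card (set l)) (d l)))) x" for l
  have p: "0 \<le> step_weight x ^ 3"
    using step_weight_pos[OF x] by simp
  \<comment> \<open>The operator applied first is peeled off, so that the induction hypothesis meets
    the forms of degree \<open>card (set l)\<close>.\<close>
  have "poly (deriv3 ((bernstein_poly n ^^ Suc j) (bpoly m c))) x = (\<Sum>l\<in>words n m. D l) / real n ^ m"
    unfolding funpow_Suc_right o_def d D_def
    by (simp add: bernstein_poly_pow_smult bernstein_poly_pow_sum higher_pderiv_smult higher_pderiv_sum poly_sum)
  then have "step_weight x ^ 3 * \<bar>poly (deriv3 ((bernstein_poly n ^^ Suc j) (bpoly m c))) x\<bar>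
     = step_weight x ^ 3 * \<bar>\<Sum>l\<in>words n m. D l\<bar> / real n ^ m"
    by (simp add: abs_divide)
  also have "\<dots> \<le> step_weight x ^ 3 * (\<Sum>l\<in>words n m. \<bar>D l\<bar>) / real n ^ m"
    using p by (intro divide_right_mono mult_left_mono sum_abs) auto
  also have "\<dots> \<le> (\<Sum>l\<in>words n m. C * iter_weight n j (card (set l))) / real n ^ m"
    unfolding sum_distrib_left D_def
    by (intro divide_right_mono sum_mono Suc.IH d_le) auto
  also have "\<dots> = C * iter_weight n (Suc j) m"
    by (simp add: sum_distrib_left)
  finally show ?case .
qed

text \<open>With a constant \<open>c\<close> in place of \<open>1/3\<close> the induction step needs
  \<open>1 - 2 c - c (a - 1) y >= 0\<close>; since \<open>a y <= 1\<close>, the value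
  \<open>1/3\<close> works.\<close>

lemma power_one_minus_ge:
  fixes y :: real
  assumes "0 \<le> y" "real a * y \<le> 1"
  shows "1 - real a * y + real a * (real a - 1) * y\<^sup>2 / 3 \<le> (1 - y) ^ a"
  using assms(2)
proof (induction a)
  case (Suc a)
  have "real a * y \<le> real (Suc a) * y" "1 * y \<le> real (Suc a) * y"
    by (rule mult_right_mono; use assms(1) in simp)+
  with Suc.prems have ay: "real a * y \<le> 1" and y: "y \<le> 1"
    by linarith+
  have "1 - real (Suc a) * y + real (Suc a) * (real (Suc a) - 1) * y\<^sup>2 / 3
      = (1 - y) * (1 - real a * y + real a * (real a - 1) * y\<^sup>2 / 3)
        - real a * y\<^sup>2 * (1 - real a * y + y) / 3"
    by (simp add: field_simps power2_eq_square)
  also have "\<dots> \<le> (1 - y) * (1 - real a * y + real a * (real a - 1) * y\<^sup>2 / 3)"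
    using ay assms(1) by (simp add: mult_nonneg_nonneg)
  also have "\<dots> \<le> (1 - y) * (1 - y) ^ a"
    using Suc.IH[OF ay] y by (intro mult_left_mono) auto
  finally show ?case by simp
qed simp

text \<open>Linearity over the boxes: a given box is missed by \<open>(n - 1)^m\<close> of the
  \<open>n^m\<close> words.\<close>

lemma sum_card_set_words:
  "(\<Sum>l\<in>words n m. real (card (set l))) = real n * (real n ^ m - (real n - 1) ^ m)"
proof (cases "n = 0")
  case False
  have count: "(\<Sum>l\<in>words n m. if b \<in> set l then 1 else 0) = real n ^ m - (real n - 1) ^ m" if "b < n" for b
  proof -
    have "card {l. set l \<subseteq> {..<n} - {b} \<and> length l = m} = (n - 1) ^ m"
      using that by (subst card_lists_length_eq) auto
    moreover have "words n m - {l. b \<in> set l} = {l. set l \<subseteq> {..<n} - {b} \<and> length l = m}"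
      by (auto simp: words_def)
    ultimately have *: "card (words n m - {l. b \<in> set l}) = (n - 1) ^ m" by simp
    have "(\<Sum>l\<in>words n m. if b \<in> set l then 1 else 0) = real (card (words n m \<inter> {l. b \<in> set l}))"
      by (simp add: sum.If_cases)
    also have "\<dots> = real n ^ m - (real n - 1) ^ m"
    proof -
      have "card (words n m) = card (words n m \<inter> {l. b \<in> set l}) + card (words n m - {l. b \<in> set l})"
        by (rule card_Int_Diff) simp
      then have "real n ^ m = real (card (words n m \<inter> {l. b \<in> set l})) + real ((n - 1) ^ m)"
        unfolding * card_words by (metis of_nat_add of_nat_power)
      then show ?thesis using False by (simp add: of_nat_diff)
    qed
    finally show ?thesis .
  qed
  have "real (card (set l)) = (\<Sum>b<n. if b \<in> set l then 1 else 0)" if "l \<in> words n m" for l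
    using that by (subst sum_lessThan_if_mem) (auto simp: words_def)
  then have "(\<Sum>l\<in>words n m. real (card (set l))) = (\<Sum>b<n. \<Sum>l\<in>words n m. if b \<in> set l then 1 else 0)"
    by (subst sum.swap) simp
  also have "\<dots> = (\<Sum>b<n. real n ^ m - (real n - 1) ^ m)"
    by (intro sum.cong refl count) simp
  finally show ?thesis by simp
qed (cases m, auto simp: words_def)

lemma sqrt_one_minus_le: "0 \<le> z \<Longrightarrow> z \<le> 1 \<Longrightarrow> sqrt (1 - z) \<le> 1 - z / 2" for z :: real
  by (rule real_le_lsqrt) (auto simp: power2_eq_square algebra_simps)

text \<open>Jensen moves the mean inside the square root. The mean number of occupied boxes is
  \<open>n (1 - (1 - 1/n)^m)\<close>, estimated by \<open>power_one_minus_ge\<close>, and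
  \<open>sqrt (1 - z) <= 1 - z/2\<close> turns \<open>1/3\<close> into \<open>1/6\<close>.\<close>

lemma mean_sqrt_card_words_le:
  assumes n: "0 < n" and m: "m \<le> n"
  shows "(\<Sum>l\<in>words n m. sqrt (real (card (set l)))) / real n ^ m
     \<le> sqrt (real m) * (1 - (real m - 1) / (6 * real n))"
proof (cases "m = 0")
  case False
  have nm: "real m / real n \<le> 1" using n m by simp
  have "(\<Sum>l\<in>words n m. sqrt (real (card (set l)))) / real n ^ m
      = (\<Sum>l\<in>words n m. 1 / real n ^ m * \<bar>sqrt (real (card (set l)))\<bar>)"
    by (simp add: sum_divide_distrib)
  also have "\<dots> \<le> sqrt (\<Sum>l\<in>words n m. 1 / real n ^ m * (sqrt (real (card (set l))))\<^sup>2)"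
    using n by (intro sum_mult_abs_le_sqrt) auto
  also have "(\<Sum>l\<in>words n m. 1 / real n ^ m * (sqrt (real (card (set l))))\<^sup>2)
      = real n * (1 - (1 - 1 / real n) ^ m)"
  proof -
    have "1 - 1 / real n = (real n - 1) / real n"
      using n by (simp add: field_simps)
    then show ?thesis
      using n by (simp add: sum_card_set_words power_divide diff_divide_distrib flip: sum_divide_distrib) (simp add: field_simps)
  qed
  also have "\<dots> \<le> real n * (real m * (1 / real n) - real m * (real m - 1) * (1 / real n)\<^sup>2 / 3)"
    using power_one_minus_ge[of "1 / real n" m] n nm by (intro mult_left_mono) auto
  also have "\<dots> = real m * (1 - (real m - 1) / (3 * real n))"
    using n by (simp add: field_simps power2_eq_square)
  finally have "(\<Sum>l\<in>words n m. sqrt (real (card (set l)))) / real n ^ m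
     \<le> sqrt (real m) * sqrt (1 - (real m - 1) / (3 * real n))"
    by (simp add: real_sqrt_mult)
  also have "\<dots> \<le> sqrt (real m) * (1 - (real m - 1) / (3 * real n) / 2)"
    using False n m by (intro mult_left_mono sqrt_one_minus_le) (auto simp: field_simps)
  finally show ?thesis by simp
qed simp

text \<open>The function \<open>6 \<surd>6 n \<surd>m\<close> is a supersolution: one Wright--Fisher step decreases it by at least \<open>deriv3_weight m\<close>.\<close>

lemma sum_iter_weight_le:
  assumes n: "0 < n" and m: "m \<le> n"
  shows "(\<Sum>j<J. iter_weight n j m) \<le> 6 * sqrt 6 * real n * sqrt (real m)"
  using m
proof (induction J arbitrary: m)
  case (Suc J)
  have le: "card (set l) \<le> n" if "l \<in> words n m" for l
    using that card_mono[of "{..<n}" "set l"] by (auto simp: words_def)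
  \<comment> \<open>The summand for \<open>j = 0\<close> is kept aside; the others are one averaging
    step applied to a partial sum of length \<open>J\<close>, which the induction hypothesis
    bounds.\<close>
  have "(\<Sum>j<J. iter_weight n (Suc j) m)
     = (\<Sum>l\<in>words n m. \<Sum>j<J. iter_weight n j (card (set l))) / real n ^ m"
    by (simp add: sum.swap[of _ "{..<J}"] flip: sum_divide_distrib)
  also have "\<dots> \<le> (\<Sum>l\<in>words n m. 6 * sqrt 6 * real n * sqrt (real (card (set l)))) / real n ^ m"
    by (intro divide_right_mono sum_mono Suc.IH le) auto
  also have "\<dots> = 6 * sqrt 6 * real n * ((\<Sum>l\<in>words n m. sqrt (real (card (set l)))) / real n ^ m)"
    by (simp add: sum_distrib_left)
  also have "\<dots> \<le> 6 * sqrt 6 * real n * (sqrt (real m) * (1 - (real m - 1) / (6 * real n)))"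
    by (intro mult_left_mono mean_sqrt_card_words_le n Suc.prems) auto
  also have "\<dots> = 6 * sqrt 6 * real n * sqrt (real m) - deriv3_weight m"
    using n by (simp add: deriv3_weight_def field_simps)
  finally show ?case
    by (simp only: sum.lessThan_Suc_shift) simp
qed simp

text \<open>Iterating \<open>p = \<rho> + bernstein_poly n p\<close> expresses \<open>p\<close> by
  iterates of \<open>\<rho>\<close>, whose coefficients are at most \<open>\<epsilon>\<close>. The
  summed weights at \<open>m = n\<close> give the constant, and the last iterate disappears as
  \<open>J\<close> grows.\<close>

lemma deriv3_bernstein_bound:
  assumes n: "0 < n" and x: "0 < x" "x < 1"
    and eps: "\<And>k. k \<le> n \<Longrightarrow> \<bar>f (real k / real n) - bernstein_op n f (real k / real n)\<bar> \<le> \<epsilon>"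
  shows "step_weight x ^ 3 * \<bar>poly (deriv3 (bpoly n (\<lambda>k. f (real k / real n)))) x\<bar>
     \<le> 6 * sqrt 6 * real n * sqrt (real n) * \<epsilon>"
proof -
  define p where "p = bpoly n (\<lambda>k. f (real k / real n))"
  define \<rho> where "\<rho> = bpoly n (\<lambda>k. f (real k / real n) - poly p (real k / real n))"
  have poly_p: "poly p x = bernstein_op n f x" for x
    by (simp add: p_def poly_bpoly bern_def bernstein_op_def)
  have e0: "0 \<le> \<epsilon>" using eps[of 0] by simp
  have p_eq: "p = \<rho> + bernstein_poly n p"
    by (rule poly_eqI_real) (simp add: \<rho>_def bernstein_poly_def poly_bpoly bern_diff, simp add: p_def poly_bpoly)
  have tele: "p = (\<Sum>j<J. (bernstein_poly n ^^ j) \<rho>) + (bernstein_poly n ^^ J) p" for J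
  proof (induction J)
    case (Suc J)
    have "(bernstein_poly n ^^ J) p = (bernstein_poly n ^^ J) \<rho> + (bernstein_poly n ^^ Suc J) p"
      by (subst p_eq) (simp add: bernstein_poly_pow_add funpow_swap1)
    then have "(\<Sum>j<J. (bernstein_poly n ^^ j) \<rho>) + (bernstein_poly n ^^ J) p
        = (\<Sum>j<Suc J. (bernstein_poly n ^^ j) \<rho>) + (bernstein_poly n ^^ Suc J) p"
      by (simp only: sum.lessThan_Suc add.assoc)
    with Suc show ?case by (rule trans)
  qed simp
  \<comment> \<open>A crude bound on the coefficients of \<open>p\<close>; it only multiplies
    \<open>iter_weight n J n\<close>, which tends to \<open>0\<close>.\<close>
  define C where "C = Max ((\<lambda>k. \<bar>f (real k / real n)\<bar>) ` {..n})"
  have C: "\<bar>f (real k / real n)\<bar> \<le> C" if "k \<le> n" for k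
    using that by (auto simp: C_def)
  let ?H = "6 * sqrt 6 * real n * sqrt (real n)"
  have "step_weight x ^ 3 * \<bar>poly (deriv3 p) x\<bar> \<le> \<epsilon> * ?H + C * iter_weight n J n" for J
  proof -
    let ?D = "\<lambda>q. poly (deriv3 q) x"
    have p3: "0 \<le> step_weight x ^ 3" using step_weight_pos[OF x] by simp
    have "?D p = (\<Sum>j<J. ?D ((bernstein_poly n ^^ j) \<rho>)) + ?D ((bernstein_poly n ^^ J) p)"
      by (subst tele[of J]) (simp add: higher_pderiv_add higher_pderiv_sum poly_sum)
    also have "\<bar>\<dots>\<bar> \<le> (\<Sum>j<J. \<bar>?D ((bernstein_poly n ^^ j) \<rho>)\<bar>) + \<bar>?D ((bernstein_poly n ^^ J) p)\<bar>"
      by (intro order_trans[OF abs_triangle_ineq] add_right_mono sum_abs)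
    finally have "step_weight x ^ 3 * \<bar>?D p\<bar>
       \<le> step_weight x ^ 3 * ((\<Sum>j<J. \<bar>?D ((bernstein_poly n ^^ j) \<rho>)\<bar>) + \<bar>?D ((bernstein_poly n ^^ J) p)\<bar>)"
      using p3 by (rule mult_left_mono)
    also have "\<dots> = (\<Sum>j<J. step_weight x ^ 3 * \<bar>?D ((bernstein_poly n ^^ j) \<rho>)\<bar>) + step_weight x ^ 3 * \<bar>?D ((bernstein_poly n ^^ J) p)\<bar>"
      by (simp add: ring_distribs sum_distrib_left)
    also have "\<dots> \<le> (\<Sum>j<J. \<epsilon> * iter_weight n j n) + C * iter_weight n J n"
      unfolding \<rho>_def using eps C
      by (intro add_mono sum_mono deriv3_iterate_bound[OF n x], simp add: poly_p)
        (subst p_def, rule deriv3_iterate_bound[OF n x])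
    also have "\<dots> \<le> \<epsilon> * ?H + C * iter_weight n J n"
      using sum_iter_weight_le[OF n order_refl, of J] e0
      by (simp add: mult_left_mono flip: sum_distrib_left)
    finally show ?thesis .
  qed
  moreover have "(\<lambda>J. \<epsilon> * ?H + C * iter_weight n J n) \<longlonglongrightarrow> \<epsilon> * ?H + C * 0"
  proof (intro tendsto_intros)
    have "summable (\<lambda>j. iter_weight n j n)"
      using iter_weight_nonneg sum_iter_weight_le[OF n order_refl]
      by (rule summableI_nonneg_bounded)
    then show "(\<lambda>J. iter_weight n J n) \<longlonglongrightarrow> 0"
      by (rule summable_LIMSEQ_zero)
  qed
  ultimately have "step_weight x ^ 3 * \<bar>poly (deriv3 p) x\<bar> \<le> \<epsilon> * ?H + C * 0"
    by (intro LIMSEQ_le_const) auto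
  then show ?thesis by (simp add: p_def mult_ac)
qed

section \<open>Local analysis\<close>

lemma bern_add: "bern n (\<lambda>i. c i + d i) x = bern n c x + bern n d x"
  by (simp add: bern_def sum.distrib ring_distribs)

lemma bern_cmult: "bern n (\<lambda>i. a * c i) x = a * bern n c x"
  by (simp add: bern_def sum_distrib_left mult_ac)

lemma bern_const [simp]: "bern n (\<lambda>i. a) x = a"
  by (simp add: bern_def flip: sum_distrib_left)

lemma bern_mono:
  assumes "x \<in> {0..1}" "\<And>i. i \<le> n \<Longrightarrow> c i \<le> d i"
  shows "bern n c x \<le> bern n d x"
  unfolding bern_def using assms by (intro sum_mono mult_right_mono) (auto simp: Bernstein_nonneg)

section \<open>Central moments of the binomial distribution\<close>

definition central_moment :: "nat \<Rightarrow> nat \<Rightarrow> real \<Rightarrow> real" where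
  "central_moment n k x = bern n (\<lambda>i. (real i - real n * x) ^ k) x"

text \<open>One further trial shifts the deviation from the mean by \<open>1 - x\<close> or
  \<open>- x\<close>; expanding the powers yields the moments by induction on
  \<open>n\<close>.\<close>

lemma central_moment_Suc_n:
  "central_moment (Suc n) k x = x * bern n (\<lambda>i. ((real i - real n * x) + (1 - x)) ^ k) x
     + (1 - x) * bern n (\<lambda>i. ((real i - real n * x) + (- x)) ^ k) x"
proof -
  have "real (Suc i) - real (Suc n) * x = (real i - real n * x) + (1 - x)"
    "real i - real (Suc n) * x = (real i - real n * x) + (- x)" for i
    by (simp_all add: algebra_simps)
  then show ?thesis by (simp only: central_moment_def bern_Suc)
qed

lemma central_moment_1: "central_moment n 1 x = 0"
proof (induction n)
  case (Suc n)
  then show ?case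
    unfolding central_moment_Suc_n by (simp only: power_one_right bern_add bern_const) (simp add: central_moment_def algebra_simps)
qed (simp add: central_moment_def)

lemma central_moment_2: "central_moment n 2 x = real n * (x * (1 - x))"
proof (induction n)
  case (Suc n)
  have e: "((real i - real n * x) + a) ^ 2 = (real i - real n * x) ^ 2 + (2 * a) * (real i - real n * x) ^ 1 + a ^ 2"
    for i a
    by (simp add: power2_eq_square algebra_simps)
  have *: "bern n (\<lambda>i. ((real i - real n * x) + a) ^ 2) x = central_moment n 2 x + (2 * a) * central_moment n 1 x + a ^ 2" for a
    unfolding e central_moment_def by (simp only: bern_add bern_cmult bern_const)
  show ?case
    unfolding central_moment_Suc_n * central_moment_1 Suc by (simp add: algebra_simps power2_eq_square)
qed (simp add: central_moment_def)

lemma central_moment_4: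
  "central_moment n 4 x = 3 * (real n * (x * (1 - x)))\<^sup>2 + real n * (x * (1 - x)) * (1 - 6 * (x * (1 - x)))"
proof (induction n)
  case (Suc n)
  have e: "((real i - real n * x) + a) ^ 4 = (real i - real n * x) ^ 4 + (4 * a) * (real i - real n * x) ^ 3
      + (6 * a\<^sup>2) * (real i - real n * x) ^ 2 + (4 * a ^ 3) * (real i - real n * x) ^ 1 + a ^ 4" for i a
    by (simp add: power4_eq_xxxx power3_eq_cube power2_eq_square algebra_simps)
  have *: "bern n (\<lambda>i. ((real i - real n * x) + a) ^ 4) x = central_moment n 4 x + (4 * a) * central_moment n 3 x
      + (6 * a\<^sup>2) * central_moment n 2 x + (4 * a ^ 3) * central_moment n 1 x + a ^ 4" for a
    unfolding e central_moment_def by (simp only: bern_add bern_cmult bern_const)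
  show ?case
    unfolding central_moment_Suc_n * central_moment_1 central_moment_2 Suc
    by (simp add: power4_eq_xxxx power3_eq_cube power2_eq_square algebra_simps)
qed (simp add: central_moment_def)

text \<open>Concavity of \<open>x (1 - x)\<close>: the weight at \<open>\<xi>\<close> between \<open>x\<close> and \<open>y\<close> is at least the linear
  interpolation between the weight at \<open>x\<close> and \<open>0\<close> at \<open>y\<close>.\<close>

lemma weight_between:
  fixes x y \<xi> :: real
  assumes "0 \<le> y" "y \<le> 1" "x \<le> \<xi> \<and> \<xi> \<le> y \<or> y \<le> \<xi> \<and> \<xi> \<le> x"
  shows "\<bar>y - \<xi>\<bar> * (x * (1 - x)) \<le> \<bar>y - x\<bar> * (\<xi> * (1 - \<xi>))"
  using assms(3)
proof
  assume *: "x \<le> \<xi> \<and> \<xi> \<le> y"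
  have "0 \<le> (\<xi> - x) * (y * (1 - y) + (y - \<xi>) * (y - x))"
    using * assms by (intro mult_nonneg_nonneg add_nonneg_nonneg) auto
  also have "\<dots> = (y - x) * (\<xi> * (1 - \<xi>)) - (y - \<xi>) * (x * (1 - x))"
    by (simp add: algebra_simps)
  finally show ?thesis using * by (simp add: abs_of_nonneg)
next
  assume *: "y \<le> \<xi> \<and> \<xi> \<le> x"
  have "0 \<le> (x - \<xi>) * (y * (1 - y) + (\<xi> - y) * (x - y))"
    using * assms by (intro mult_nonneg_nonneg add_nonneg_nonneg) auto
  also have "\<dots> = (x - y) * (\<xi> * (1 - \<xi>)) - (\<xi> - y) * (x * (1 - x))"
    by (simp add: algebra_simps)
  finally have "(\<xi> - y) * (x * (1 - x)) \<le> (x - y) * (\<xi> * (1 - \<xi>))" by simp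
  moreover have "\<bar>y - \<xi>\<bar> = \<xi> - y" "\<bar>y - x\<bar> = x - y" using * by auto
  ultimately show ?thesis by (simp only:)
qed

text \<open>With \<open>u = |y - \<xi>|\<close>, \<open>v = |y - x|\<close> and
  \<open>w(t) = t (1 - t)\<close>, the squared claim is
  \<open>u (u w(x))^3 <= v (v w(\<xi>))^3\<close>: three factors come from
  \<open>weight_between\<close>, the fourth from \<open>u <= v\<close>.\<close>

lemma weight_between_cube:
  assumes x: "0 < x" "x < 1" and y: "0 \<le> y" "y \<le> 1"
    and \<xi>: "x \<le> \<xi> \<and> \<xi> \<le> y \<or> y \<le> \<xi> \<and> \<xi> \<le> x" "0 < \<xi>" "\<xi> < 1"
  shows "(y - \<xi>)\<^sup>2 * step_weight x ^ 3 \<le> (y - x)\<^sup>2 * step_weight \<xi> ^ 3"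
proof (rule power2_le_imp_le)
  let ?u = "\<bar>y - \<xi>\<bar>" and ?v = "\<bar>y - x\<bar>"
  have "((y - \<xi>)\<^sup>2 * step_weight x ^ 3)\<^sup>2 = ?u * (?u * (x * (1 - x))) ^ 3"
    unfolding power_mult_distrib[of "(y - \<xi>)\<^sup>2"] step_weight_pow6[OF x]
    by (simp add: power_mult_distrib power4_eq_xxxx power3_eq_cube power2_eq_square abs_mult_self_eq flip: abs_mult)
  also have "\<dots> \<le> ?v * (?v * (\<xi> * (1 - \<xi>))) ^ 3"
    using \<xi>(1) x by (intro mult_mono power_mono weight_between[OF y \<xi>(1)]) auto
  also have "\<dots> = ((y - x)\<^sup>2 * step_weight \<xi> ^ 3)\<^sup>2"
    unfolding power_mult_distrib[of "(y - x)\<^sup>2"] step_weight_pow6[OF \<xi>(2,3)]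
    by (simp add: power_mult_distrib power4_eq_xxxx power3_eq_cube power2_eq_square abs_mult_self_eq flip: abs_mult)
  finally show "((y - \<xi>)\<^sup>2 * step_weight x ^ 3)\<^sup>2 \<le> ((y - x)\<^sup>2 * step_weight \<xi> ^ 3)\<^sup>2" .
  show "0 \<le> (y - x)\<^sup>2 * step_weight \<xi> ^ 3"
    using step_weight_pos[OF \<xi>(2,3)] by simp
qed

section \<open>Taylor estimates under a weighted bound on the third derivative\<close>

abbreviation deriv2 :: "real poly \<Rightarrow> real poly" where
  "deriv2 p \<equiv> pderiv (pderiv p)"

text \<open>The Cauchy form is chosen because its factor \<open>(y - \<xi>)^2\<close> compensates
  the growth that the weighted bound allows \<open>deriv3 p\<close> when \<open>\<xi>\<close> is
  near an endpoint.\<close>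

lemma taylor_cauchy_remainder:
  fixes p :: "real poly"
  assumes "x \<noteq> y"
  obtains \<xi> where "x < \<xi> \<and> \<xi> < y \<or> y < \<xi> \<and> \<xi> < x"
    "poly p y - poly p x - poly (pderiv p) x * (y - x) - poly (deriv2 p) x * (y - x)\<^sup>2 / 2
       = (y - x) * (poly (deriv3 p) \<xi> * (y - \<xi>)\<^sup>2 / 2)"
proof -
  define F where "F t = poly p t + poly (pderiv p) t * (y - t) + poly (deriv2 p) t * (y - t)\<^sup>2 / 2" for t
  define F' where "F' t = poly (deriv3 p) t * (y - t)\<^sup>2 / 2" for t
  have D: "DERIV F t :> F' t" for t
    unfolding F_def F'_def numeral_3_eq_3
    by (auto intro!: derivative_eq_intros poly_DERIV) (simp add: field_simps power2_eq_square)
  have "\<exists>\<xi>. (x < \<xi> \<and> \<xi> < y \<or> y < \<xi> \<and> \<xi> < x) \<and> F y - F x = (y - x) * F' \<xi>"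
  proof (cases "x < y")
    case True
    from MVT2[OF this, of F F'] D show ?thesis by blast
  next
    case False
    with assms have "y < x" by simp
    from MVT2[OF this, of F F'] D obtain z where "y < z" "z < x" "F x - F y = (x - y) * F' z" by blast
    then show ?thesis by (intro exI[of _ z]) (simp add: algebra_simps)
  qed
  then show thesis using that unfolding F_def F'_def by (auto simp: algebra_simps)
qed

context
  fixes p :: "real poly" and D :: real
  assumes d3: "\<And>t. 0 < t \<Longrightarrow> t < 1 \<Longrightarrow> step_weight t ^ 3 * \<bar>poly (deriv3 p) t\<bar> \<le> D"
begin

lemma deriv3_bound_nonneg: "0 \<le> D"
  by (rule order_trans[OF _ d3[of "1/2"]]) (auto simp: step_weight_def)

lemma taylor_bound:
  assumes x: "0 < x" "x < 1" and y: "0 \<le> y" "y \<le> 1"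
  shows "\<bar>poly p y - poly p x - poly (pderiv p) x * (y - x) - poly (deriv2 p) x * (y - x)\<^sup>2 / 2\<bar>
     \<le> D / (2 * step_weight x ^ 3) * \<bar>y - x\<bar> ^ 3"
proof (cases "x = y")
  case True
  then show ?thesis by simp
next
  case False
  then obtain \<xi> where \<xi>: "x < \<xi> \<and> \<xi> < y \<or> y < \<xi> \<and> \<xi> < x"
    and eq: "poly p y - poly p x - poly (pderiv p) x * (y - x) - poly (deriv2 p) x * (y - x)\<^sup>2 / 2
       = (y - x) * (poly (deriv3 p) \<xi> * (y - \<xi>)\<^sup>2 / 2)"
    by (rule taylor_cauchy_remainder)
  have \<xi>01: "0 < \<xi>" "\<xi> < 1" using \<xi> x y by auto
  define A where "A = step_weight x ^ 3"
  define B where "B = step_weight \<xi> ^ 3"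
  define T where "T = \<bar>poly (deriv3 p) \<xi>\<bar>"
  have pos: "0 < A" "0 < B" "0 \<le> T"
    using step_weight_pos x \<xi>01 by (auto simp: A_def B_def T_def)
  have "(y - \<xi>)\<^sup>2 * A \<le> (y - x)\<^sup>2 * B"
    unfolding A_def B_def using weight_between_cube[OF x y _ \<xi>01] \<xi> by auto
  then have "T * ((y - \<xi>)\<^sup>2 * A) \<le> T * ((y - x)\<^sup>2 * B)"
    using pos by (intro mult_left_mono)
  also have "\<dots> = (y - x)\<^sup>2 * (B * T)" by simp
  also have "\<dots> \<le> (y - x)\<^sup>2 * D"
    unfolding B_def T_def using d3[OF \<xi>01] by (intro mult_left_mono) auto
  finally have "T * (y - \<xi>)\<^sup>2 \<le> D / A * (y - x)\<^sup>2"
    using pos by (simp add: field_simps)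
  then have "\<bar>y - x\<bar> * (T * (y - \<xi>)\<^sup>2 / 2) \<le> \<bar>y - x\<bar> * (D / A * (y - x)\<^sup>2 / 2)"
    by (intro mult_left_mono divide_right_mono) auto
  also have "\<dots> = D / (2 * A) * \<bar>y - x\<bar> ^ 3"
  proof -
    have "\<bar>y - x\<bar> ^ 3 = \<bar>y - x\<bar> * \<bar>y - x\<bar>\<^sup>2"
      by (simp only: power3_eq_cube power2_eq_square mult.assoc)
    then show ?thesis by (simp add: mult_ac)
  qed
  finally show ?thesis
    unfolding eq A_def T_def by (simp add: abs_mult)
qed

text \<open>Voronovskaya's expansion: under the binomial mean the linear Taylor term vanishes, the
  quadratic one gives \<open>p''(x) x (1 - x) / (2 n)\<close>, and \<open>taylor_bound\<close>
  reduces the remainder to the third absolute moment.\<close>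

lemma weighted_deriv2_inner:
  assumes n: "0 < n" and x: "0 < x" "x < 1" and nx: "1 \<le> real n * (x * (1 - x))"
    and eps: "\<bar>bern n (\<lambda>k. poly p (real k / real n)) x - poly p x\<bar> \<le> \<epsilon>"
  shows "x * (1 - x) * \<bar>poly (deriv2 p) x\<bar> \<le> 2 * real n * \<epsilon> + 2 * D / sqrt (real n)"
proof -
  define w where "w = x * (1 - x)"
  define \<phi> where "\<phi> = step_weight x"
  define s where "s = \<phi> / sqrt (real n)"
  define z where "z k = real k / real n - x" for k :: nat
  have w: "0 < w" "\<phi>\<^sup>2 = w" "0 < \<phi>" "0 < s" and x01: "x \<in> {0..1}"
    using x n by (simp_all add: w_def \<phi>_def s_def step_weight_sq step_weight_pos)
  have s2: "s\<^sup>2 = w / real n"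
    using n by (simp add: s_def power_divide w)
  have zk: "z k = (real k - real n * x) / real n" for k
    using n by (simp add: z_def field_simps)
  have z1: "bern n z x = 0"
    using central_moment_1[of n x] bern_cmult[of n "1 / real n" "\<lambda>k. real k - real n * x" x]
    by (simp add: zk[abs_def] central_moment_def)
  have z2: "bern n (\<lambda>k. (z k)\<^sup>2) x = s\<^sup>2"
  proof -
    have "bern n (\<lambda>k. (z k)\<^sup>2) x = 1 / (real n)\<^sup>2 * central_moment n 2 x"
      unfolding zk central_moment_def bern_cmult[symmetric] by (simp add: power_divide)
    then show ?thesis
      using n by (simp only: central_moment_2 s2 w_def) (simp add: field_simps power2_eq_square)
  qed
  have "bern n (\<lambda>k. (z k) ^ 4) x = (3 * (real n * w)\<^sup>2 + real n * w * (1 - 6 * w)) / real n ^ 4"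
    using central_moment_4[of n x] bern_cmult[of n "1 / real n ^ 4" "\<lambda>k. (real k - real n * x) ^ 4" x]
    by (simp add: zk power_divide central_moment_def w_def)
  \<comment> \<open>Here \<open>nx\<close> enters: \<open>1 - 6 w <= 1 <= n w\<close> absorbs the
    lower-order part of the fourth moment.\<close>
  also have "\<dots> \<le> (3 * (real n * w)\<^sup>2 + real n * w * (real n * w)) / real n ^ 4"
    using nx w n by (intro divide_right_mono add_left_mono mult_left_mono) (auto simp: w_def[symmetric])
  also have "\<dots> = 4 * (s\<^sup>2)\<^sup>2"
    unfolding s2 using n by (simp add: field_simps power4_eq_xxxx power2_eq_square)
  finally have z4: "bern n (\<lambda>k. (z k) ^ 4) x \<le> 4 * (s\<^sup>2)\<^sup>2" .
  \<comment> \<open>The scale \<open>s\<close> is the standard deviation of \<open>z\<close>, chosen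
    so that the second and the fourth moment each contribute at most \<open>s^3\<close>.\<close>
  have "\<bar>z k\<bar> ^ 3 \<le> s * (z k)\<^sup>2 + 1 / (4 * s) * (z k) ^ 4" for k
  proof -
    have "0 \<le> (2 * s - \<bar>z k\<bar>)\<^sup>2" by simp
    then have "\<bar>z k\<bar> \<le> s + (z k)\<^sup>2 / (4 * s)"
      using w by (simp add: field_simps power2_eq_square)
    then have "\<bar>z k\<bar>\<^sup>2 * \<bar>z k\<bar> \<le> \<bar>z k\<bar>\<^sup>2 * (s + (z k)\<^sup>2 / (4 * s))"
      by (intro mult_left_mono) auto
    then show ?thesis by (simp add: power3_eq_cube power2_eq_square power4_eq_xxxx algebra_simps)
  qed
  then have "bern n (\<lambda>k. \<bar>z k\<bar> ^ 3) x \<le> bern n (\<lambda>k. s * (z k)\<^sup>2 + 1 / (4 * s) * (z k) ^ 4) x"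
    by (intro bern_mono x01)
  also have "\<dots> = s * s\<^sup>2 + 1 / (4 * s) * bern n (\<lambda>k. (z k) ^ 4) x"
    by (simp only: bern_add bern_cmult z2)
  also have "\<dots> \<le> s * s\<^sup>2 + 1 / (4 * s) * (4 * (s\<^sup>2)\<^sup>2)"
    using z4 w by (intro add_left_mono mult_left_mono) auto
  also have "\<dots> = 2 * s ^ 3"
    using w by (simp add: power2_eq_square power3_eq_cube)
  finally have z3: "bern n (\<lambda>k. \<bar>z k\<bar> ^ 3) x \<le> 2 * s ^ 3" .
  define R where "R k = poly p (real k / real n) - poly p x - poly (pderiv p) x * z k
     - poly (deriv2 p) x / 2 * (z k)\<^sup>2" for k
  have R: "\<bar>R k\<bar> \<le> D / (2 * \<phi> ^ 3) * \<bar>z k\<bar> ^ 3" if "k \<le> n" for k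
    using taylor_bound[OF x, of "real k / real n"] that n by (simp add: R_def z_def \<phi>_def)
  have "bern n R x = bern n (\<lambda>k. poly p (real k / real n)) x - poly p x - poly (deriv2 p) x / 2 * s\<^sup>2"
    unfolding R_def by (simp only: bern_diff bern_cmult bern_const z1 z2)
  then have "\<bar>poly (deriv2 p) x / 2 * s\<^sup>2\<bar> \<le> \<epsilon> + \<bar>bern n R x\<bar>"
    using eps by linarith
  also have "\<bar>bern n R x\<bar> \<le> bern n (\<lambda>k. \<bar>R k\<bar>) x"
    unfolding bern_def using x by (intro order_trans[OF sum_abs]) (simp add: abs_mult Bernstein_nonneg)
  also have "\<dots> \<le> bern n (\<lambda>k. D / (2 * \<phi> ^ 3) * \<bar>z k\<bar> ^ 3) x"
    by (intro bern_mono x01 R)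
  also have "\<dots> \<le> D / (2 * \<phi> ^ 3) * (2 * s ^ 3)"
    unfolding bern_cmult using z3 deriv3_bound_nonneg w by (intro mult_left_mono) auto
  also have "\<dots> = D / (real n * sqrt (real n))"
    using w n by (simp add: s_def power_divide power3_eq_cube)
  finally have "\<bar>poly (deriv2 p) x\<bar> / 2 * (w / real n) \<le> \<epsilon> + D / (real n * sqrt (real n))"
    using w n by (simp add: abs_mult s2)
  then have "2 * real n * (\<bar>poly (deriv2 p) x\<bar> / 2 * (w / real n)) \<le> 2 * real n * (\<epsilon> + D / (real n * sqrt (real n)))"
    by (intro mult_left_mono) auto
  moreover have "2 * real n * (\<bar>poly (deriv2 p) x\<bar> / 2 * (w / real n)) = w * \<bar>poly (deriv2 p) x\<bar>"
    "2 * real n * (\<epsilon> + D / (real n * sqrt (real n))) = 2 * real n * \<epsilon> + 2 * D / sqrt (real n)"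
    using n by (simp_all add: distrib_left)
  ultimately show ?thesis by (simp only: w_def)
qed

text \<open>The function \<open>g\<close> is an antiderivative of
  \<open>1 / (2 step_weight^3)\<close>, so \<open>2 D g\<close> plus or minus
  \<open>deriv2 p\<close> is nondecreasing.\<close>

lemma deriv2_diff_bound:
  assumes "0 < x" "x < y" "y < 1"
  shows "\<bar>poly (deriv2 p) y - poly (deriv2 p) x\<bar>
     \<le> 2 * D * ((2 * y - 1) / step_weight y - (2 * x - 1) / step_weight x)"
proof -
  define g where "g t = (2 * t - 1) / step_weight t" for t
  have Dg: "DERIV g t :> 1 / (2 * step_weight t ^ 3)" if t: "0 < t" "t < 1" for t
  proof -
    define q where "q = step_weight t"
    have q: "0 < q" "q\<^sup>2 = t * (1 - t)"
      using t by (simp_all add: q_def step_weight_pos step_weight_sq)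
    have "DERIV step_weight t :> (1 - 2 * t) / (2 * q)"
      unfolding step_weight_def[abs_def] q_def using t
      by (auto intro!: derivative_eq_intros simp: step_weight_def field_simps)
    then have "DERIV g t :> (2 * q - (2 * t - 1) * ((1 - 2 * t) / (2 * q))) / (q * q)"
      unfolding g_def[abs_def] using q
      by (auto intro!: derivative_eq_intros simp: q_def)
    moreover have "(2 * q - (2 * t - 1) * ((1 - 2 * t) / (2 * q))) / (q * q) = (4 * q\<^sup>2 + (1 - 2 * t)\<^sup>2) / (2 * q ^ 3)"
      using q(1) by (simp add: field_simps power2_eq_square power3_eq_cube)
    moreover have "4 * q\<^sup>2 + (1 - 2 * t)\<^sup>2 = 1"
      unfolding q(2) by (simp add: power2_eq_square algebra_simps)
    ultimately show ?thesis by (simp add: q_def)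
  qed
  have bnd: "\<bar>poly (deriv3 p) t\<bar> \<le> 2 * D * (1 / (2 * step_weight t ^ 3))" if "0 < t" "t < 1" for t
    using d3[OF that] step_weight_pos[OF that] by (simp add: field_simps)
  have D3: "DERIV (poly (deriv2 p)) t :> poly (deriv3 p) t" for t
    by (simp add: numeral_3_eq_3)
  have mono: "2 * D * g x - \<sigma> * poly (deriv2 p) x \<le> 2 * D * g y - \<sigma> * poly (deriv2 p) y"
    if \<sigma>: "\<bar>\<sigma>\<bar> = 1" for \<sigma> :: real
  proof (rule DERIV_nonneg_imp_nondecreasing[where f = "\<lambda>t. 2 * D * g t - \<sigma> * poly (deriv2 p) t"])
    fix t assume "x \<le> t" "t \<le> y"
    then have t: "0 < t" "t < 1" using assms by auto
    have "DERIV (\<lambda>t. 2 * D * g t - \<sigma> * poly (deriv2 p) t) t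
        :> 2 * D * (1 / (2 * step_weight t ^ 3)) - \<sigma> * poly (deriv3 p) t"
      by (intro DERIV_diff DERIV_cmult Dg t D3)
    moreover have "\<sigma> * poly (deriv3 p) t \<le> \<bar>poly (deriv3 p) t\<bar>"
      using \<sigma> abs_ge_self[of "\<sigma> * poly (deriv3 p) t"] by (simp add: abs_mult)
    ultimately show "\<exists>d. DERIV (\<lambda>t. 2 * D * g t - \<sigma> * poly (deriv2 p) t) t :> d \<and> 0 \<le> d"
      using bnd[OF t] by (intro exI conjI) (assumption, simp)
  qed (use assms in simp)
  from mono[of 1] mono[of "-1"] show ?thesis
    unfolding g_def by (simp add: algebra_simps abs_le_iff)
qed

text \<open>Where \<open>n x (1 - x) < 1\<close>, the inner estimate is applied at the nearest point
  with \<open>n t (1 - t) = 1\<close>, and \<open>deriv2_diff_bound\<close> carries it to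
  \<open>x\<close>.\<close>

lemma weighted_deriv2:
  assumes n: "4 < n" and x: "0 < x" "x < 1"
    and eps: "\<And>y. 0 < y \<Longrightarrow> y < 1 \<Longrightarrow> \<bar>bern n (\<lambda>k. poly p (real k / real n)) y - poly p y\<bar> \<le> \<epsilon>"
  shows "x * (1 - x) * \<bar>poly (deriv2 p) x\<bar>
     \<le> 2 * real n * \<epsilon> + 2 * D / sqrt (real n) * (1 + 4 / real n)"
proof -
  have e0: "0 \<le> \<epsilon>" using eps[of "1/2"] by simp
  define Q where "Q = 2 * D / sqrt (real n)"
  have Q: "0 \<le> Q" using deriv3_bound_nonneg by (simp add: Q_def)
  have inner: "y * (1 - y) * \<bar>poly (deriv2 p) y\<bar> \<le> 2 * real n * \<epsilon> + Q"
    if "0 < y" "y < 1" "1 \<le> real n * (y * (1 - y))" for y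
    unfolding Q_def using weighted_deriv2_inner[of n y \<epsilon>] n that eps by auto
  show ?thesis
  proof (cases "1 \<le> real n * (x * (1 - x))")
    case True
    have "Q * 1 \<le> Q * (1 + 4 / real n)"
      using Q by (intro mult_left_mono) auto
    with inner[OF x True] show ?thesis unfolding Q_def by simp
  next
    case False
    \<comment> \<open>The smaller root of \<open>t (1 - t) = 1/n\<close>, real and below
      \<open>1/2\<close> because \<open>n > 4\<close>.\<close>
    define x1 where "x1 = (1 - sqrt (1 - 4 / real n)) / 2"
    have r: "0 < 1 - 4 / real n" "1 - 4 / real n < 1" using n by auto
    then have x1: "0 < x1" "x1 < 1 / 2" by (auto simp: x1_def)
    have "x1 * (1 - x1) = (1 - (sqrt (1 - 4 / real n))\<^sup>2) / 4"
      by (simp add: x1_def power2_eq_square field_simps)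
    then have x1w: "x1 * (1 - x1) = 1 / real n"
      using r by simp
    then have sw1: "step_weight x1 = 1 / sqrt (real n)" "step_weight (1 - x1) = 1 / sqrt (real n)"
      by (simp_all add: step_weight_def real_sqrt_divide mult.commute)
    have "x1 * (1 / 2) \<le> x1 * (1 - x1)" using x1 by (intro mult_left_mono) auto
    then have x1n: "x1 \<le> 2 / real n" unfolding x1w by simp
    define \<phi> where "\<phi> = step_weight x"
    have \<phi>: "0 < \<phi>" "\<phi>\<^sup>2 = x * (1 - x)" using x by (simp_all add: \<phi>_def step_weight_pos step_weight_sq)
    define v where "v = \<phi> * sqrt (real n)"
    have v2: "v\<^sup>2 = real n * (x * (1 - x))" by (simp add: v_def power_mult_distrib \<phi>)
    have "v\<^sup>2 \<le> 1" unfolding v2 using False by simp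
    then have v: "0 \<le> v" "v \<le> 1"
      using \<phi> by (simp_all add: v_def abs_square_le_1)
    have neg: "(x - x1) * (1 - x - x1) < 0"
    proof -
      have "(x - x1) * (1 - x - x1) = x * (1 - x) - 1 / real n"
        using x1w by (simp add: algebra_simps)
      moreover have "x * (1 - x) < 1 / real n"
        using False n by (subst pos_less_divide_eq) (auto simp: mult.commute)
      ultimately show ?thesis by simp
    qed
    have at1: "\<bar>poly (deriv2 p) y\<bar> \<le> real n * (2 * real n * \<epsilon> + Q)" if "y = x1 \<or> y = 1 - x1" for y
    proof -
      have yw: "y * (1 - y) = 1 / real n" using that x1w by (auto simp: mult.commute)
      have "0 < y" "y < 1" using that x1 by auto
      from inner[OF this] n show ?thesis unfolding yw by (simp add: field_simps)
    qed
    have "\<bar>poly (deriv2 p) x\<bar> \<le> real n * (2 * real n * \<epsilon> + Q) + 2 * D * (1 / \<phi> - (1 - 2 * x1) * sqrt (real n))"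
    proof (cases "x \<le> 1 / 2")
      case True
      then have "x < x1" using neg x1 by (auto simp: mult_less_0_iff)
      from deriv2_diff_bound[OF x(1) this] x1
      have *: "\<bar>poly (deriv2 p) x1 - poly (deriv2 p) x\<bar> \<le> 2 * D * ((2 * x1 - 1) * sqrt (real n) - (2 * x - 1) / \<phi>)"
        by (simp add: sw1 \<phi>_def)
      have "(1 - 2 * x) / \<phi> \<le> 1 / \<phi>" using \<phi> x by (intro divide_right_mono) auto
      then have "2 * D * ((2 * x1 - 1) * sqrt (real n) - (2 * x - 1) / \<phi>)
          \<le> 2 * D * (1 / \<phi> - (1 - 2 * x1) * sqrt (real n))"
        using deriv3_bound_nonneg by (intro mult_left_mono) (auto simp: algebra_simps diff_divide_distrib)
      with * at1[of x1] show ?thesis by linarith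
    next
      case F: False
      then have lt: "1 - x1 < x" using neg x1 by (auto simp: mult_less_0_iff)
      from deriv2_diff_bound[OF _ this x(2)] x1
      have *: "\<bar>poly (deriv2 p) x - poly (deriv2 p) (1 - x1)\<bar>
          \<le> 2 * D * ((2 * x - 1) / \<phi> - (2 * (1 - x1) - 1) * sqrt (real n))"
        by (simp add: sw1 \<phi>_def)
      have "(2 * x - 1) / \<phi> \<le> 1 / \<phi>" using \<phi> x by (intro divide_right_mono) auto
      then have "2 * D * ((2 * x - 1) / \<phi> - (2 * (1 - x1) - 1) * sqrt (real n))
          \<le> 2 * D * (1 / \<phi> - (1 - 2 * x1) * sqrt (real n))"
        using deriv3_bound_nonneg by (intro mult_left_mono) (auto simp: algebra_simps diff_divide_distrib)
      with * at1[of "1 - x1"] show ?thesis by linarith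
    qed
    then have "\<phi>\<^sup>2 * \<bar>poly (deriv2 p) x\<bar>
       \<le> \<phi>\<^sup>2 * (real n * (2 * real n * \<epsilon> + Q) + 2 * D * (1 / \<phi> - (1 - 2 * x1) * sqrt (real n)))"
      by (intro mult_left_mono) auto
    \<comment> \<open>The contribution \<open>Q v^2\<close> of the reference point cancels against
      part of the transport term. Beyond \<open>Q v\<close> only \<open>2 Q x1 v^2\<close> is left,
      and \<open>x1 <= 2/n\<close> produces the \<open>4/n\<close>.\<close>
    also have "\<dots> = v\<^sup>2 * (2 * real n * \<epsilon>) + Q * (v + 2 * x1 * v\<^sup>2)"
    proof -
      have D: "2 * D = Q * sqrt (real n)" using n by (simp add: Q_def)
      define u where "u = 1 / \<phi>"
      define r where "r = sqrt (real n)"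
      have u: "\<phi>\<^sup>2 * u = \<phi>" using \<phi>(1) by (simp add: u_def power2_eq_square)
      have "\<phi>\<^sup>2 * (real n * (2 * real n * \<epsilon> + Q) + Q * r * (u - (1 - 2 * x1) * r))
        = (\<phi>\<^sup>2 * real n) * (2 * real n * \<epsilon> + Q) + Q * ((\<phi>\<^sup>2 * u) * r) - Q * (\<phi>\<^sup>2 * (r * r)) * (1 - 2 * x1)"
        by (simp add: algebra_simps)
      also have "r * r = real n" by (simp add: r_def)
      also have "\<phi>\<^sup>2 * real n = v\<^sup>2" by (simp add: v_def power_mult_distrib)
      finally show ?thesis
        unfolding D u by (simp add: v_def u_def r_def algebra_simps)
    qed
    also have "\<dots> \<le> 1 * (2 * real n * \<epsilon>) + Q * (1 + 2 * (2 / real n) * 1)"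
      using v e0 Q x1 x1n by (intro add_mono mult_mono mult_left_mono power_le_one) auto
    finally show ?thesis by (simp add: \<phi> Q_def)
  qed
qed

end

lemma second_diff_poly_bound:
  assumes K: "\<And>t. 0 < t \<Longrightarrow> t < 1 \<Longrightarrow> t * (1 - t) * \<bar>poly (deriv2 p) t\<bar> \<le> K"
    and h: "0 \<le> h" and x: "x \<in> {0..1}"
    and xs: "x + h * step_weight x \<in> {0..1}" "x - h * step_weight x \<in> {0..1}"
  shows "\<bar>second_diff (h * step_weight x) (poly p) x\<bar> \<le> 2 * K * h\<^sup>2"
proof -
  define s where "s = h * step_weight x"
  have K0: "0 \<le> K" by (rule order_trans[OF _ K[of "1/2"]]) auto
  have s0: "0 \<le> s" using h x by (simp add: s_def step_weight_def)
  show ?thesis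
  proof (cases "s = 0")
    case True
    then show ?thesis using K0 by (simp add: s_def[symmetric] second_diff_def)
  next
    case False
    then have s: "0 < s" using s0 by simp
    have x01: "0 < x" "x < 1" using s xs by (auto simp: s_def[symmetric])
    define w where "w = x * (1 - x)"
    have w: "0 < w" using x01 by (simp add: w_def)
    \<comment> \<open>\<open>F 0 = 2 p(x)\<close>, \<open>F s = p(x + s) + p(x - s)\<close>, and the
      first derivatives cancel in \<open>F'\<close>. The factor \<open>s - u\<close> again
      compensates the weight, through \<open>weight_between\<close>.\<close>
    define F where "F u = poly p (x + u) + poly p (x - u) + (s - u) * (poly (pderiv p) (x + u) - poly (pderiv p) (x - u))" for u
    define F' where "F' u = (s - u) * (poly (deriv2 p) (x + u) + poly (deriv2 p) (x - u))" for u
    have pd: "DERIV (\<lambda>u. poly q (x + u)) u :> poly (pderiv q) (x + u)"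
      "DERIV (\<lambda>u. poly q (x - u)) u :> - poly (pderiv q) (x - u)" for q :: "real poly" and u
      by (auto intro!: derivative_eq_intros DERIV_chain'[OF _ poly_DERIV])
    have "DERIV F u :> F' u" for u
      unfolding F_def F'_def by (auto intro!: derivative_eq_intros pd simp: algebra_simps)
    then obtain \<xi> where \<xi>: "0 < \<xi>" "\<xi> < s" "F s - F 0 = (s - 0) * F' \<xi>"
      using MVT2[OF s, of F F'] by blast
    have part: "(s - \<xi>) * \<bar>poly (deriv2 p) t\<bar> \<le> K * s / w" if "t = x + \<xi> \<or> t = x - \<xi>" for t
    proof -
      have t: "0 < t" "t < 1" using that \<xi> xs by (auto simp: s_def[symmetric])
      have "(s - \<xi>) * w \<le> s * (t * (1 - t))"
        using that weight_between[of "x + s" x t] weight_between[of "x - s" x t] \<xi> s xs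
        by (auto simp: s_def[symmetric] w_def)
      then have "\<bar>poly (deriv2 p) t\<bar> * ((s - \<xi>) * w) \<le> \<bar>poly (deriv2 p) t\<bar> * (s * (t * (1 - t)))"
        by (intro mult_left_mono) auto
      also have "\<dots> = s * (t * (1 - t) * \<bar>poly (deriv2 p) t\<bar>)" by simp
      also have "\<dots> \<le> s * K" using K[OF t] s by (intro mult_left_mono) auto
      finally show ?thesis using w by (simp add: field_simps)
    qed
    have "\<bar>F' \<xi>\<bar> \<le> (s - \<xi>) * (\<bar>poly (deriv2 p) (x + \<xi>)\<bar> + \<bar>poly (deriv2 p) (x - \<xi>)\<bar>)"
      unfolding F'_def abs_mult using \<xi> by (intro mult_mono abs_triangle_ineq) auto
    also have "\<dots> \<le> 2 * (K * s / w)"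
      using part[of "x + \<xi>"] part[of "x - \<xi>"] by (simp add: distrib_left)
    finally have "s * \<bar>F' \<xi>\<bar> \<le> s * (2 * (K * s / w))"
      using s by (intro mult_left_mono) auto
    moreover have "second_diff s (poly p) x = s * F' \<xi>"
      using \<xi>(3) by (simp add: F_def second_diff_def)
    moreover have "s * (2 * (K * s / w)) = 2 * K * h\<^sup>2"
    proof -
      have "s\<^sup>2 = h\<^sup>2 * w" using x01 by (simp add: s_def power_mult_distrib step_weight_sq w_def)
      then show ?thesis using w by (simp add: field_simps power2_eq_square)
    qed
    ultimately show ?thesis using s by (simp add: s_def[symmetric] abs_mult)
  qed
qed

section \<open>The two bounds\<close>

lemma bernstein_op_eq_poly: "bernstein_op n f x = poly (bpoly n (\<lambda>k. f (real k / real n))) x"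
  by (simp add: poly_bpoly bern_def bernstein_op_def)

lemma abs_le_sup_norm:
  assumes "continuous_on {0..1} f" "x \<in> {0..1}"
  shows "\<bar>f x\<bar> \<le> sup_norm f"
proof -
  have "compact ((\<lambda>x. \<bar>f x\<bar>) ` {0..1})"
    using assms(1) by (intro compact_continuous_image continuous_intros) auto
  then have "bdd_above ((\<lambda>x. \<bar>f x\<bar>) ` {0..1})"
    by (intro bounded_imp_bdd_above compact_imp_bounded)
  then show ?thesis
    unfolding sup_norm_def using assms(2) by (rule cSUP_upper[rotated])
qed

lemma sup_norm_le:
  assumes "\<And>x. x \<in> {0..1} \<Longrightarrow> \<bar>f x\<bar> \<le> C"
  shows "sup_norm f \<le> C"
  unfolding sup_norm_def using assms by (intro cSUP_least) auto

lemma continuous_on_bernstein_error: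
  "continuous_on {0..1} f \<Longrightarrow> continuous_on {0..1} (\<lambda>x. bernstein_op n f x - f x)"
  unfolding bernstein_op_eq_poly by (intro continuous_intros)

lemma second_diff_le:
  assumes n: "100 \<le> n" and f: "continuous_on {0..1} f"
    and h: "0 \<le> h" "h \<le> 1 / sqrt (real n)" and x: "x \<in> {0..1}"
    and xs: "x + h * step_weight x \<in> {0..1}" "x - h * step_weight x \<in> {0..1}"
  shows "\<bar>second_diff (h * step_weight x) f x\<bar> \<le> 70 * sup_norm (\<lambda>x. bernstein_op n f x - f x)"
proof -
  define \<epsilon> where "\<epsilon> = sup_norm (\<lambda>x. bernstein_op n f x - f x)"
  define p where "p = bpoly n (\<lambda>k. f (real k / real n))"
  have p: "poly p x = bernstein_op n f x" for x
    by (simp add: p_def bernstein_op_eq_poly)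
  have eps: "\<bar>poly p y - f y\<bar> \<le> \<epsilon>" if "y \<in> {0..1}" for y
    unfolding p \<epsilon>_def using abs_le_sup_norm[OF continuous_on_bernstein_error[OF f] that] .
  have e0: "0 \<le> \<epsilon>" using eps[of 0] by (auto intro: order_trans[OF abs_ge_zero])
  define D where "D = 6 * sqrt 6 * real n * sqrt (real n) * \<epsilon>"
  have d3: "step_weight t ^ 3 * \<bar>poly (deriv3 p) t\<bar> \<le> D" if "0 < t" "t < 1" for t
    unfolding p_def D_def
  proof (rule deriv3_bernstein_bound[OF _ that])
    fix k assume "k \<le> n"
    then show "\<bar>f (real k / real n) - bernstein_op n f (real k / real n)\<bar> \<le> \<epsilon>"
      using eps[of "real k / real n"] n by (simp add: p abs_minus_commute)
  qed (use n in simp)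
  \<comment> \<open>\<open>poly p\<close> is the Bernstein polynomial of \<open>f\<close>, so its
    own error is a binomial mean of the values of \<open>p - f\<close> at the nodes.\<close>
  have bern_err: "\<bar>bern n (\<lambda>k. poly p (real k / real n)) y - poly p y\<bar> \<le> \<epsilon>" if y: "0 < y" "y < 1" for y
  proof -
    have "bern n (\<lambda>k. poly p (real k / real n)) y - poly p y
        = bern n (\<lambda>k. poly p (real k / real n) - f (real k / real n)) y"
      by (simp add: bern_diff p_def poly_bpoly)
    then show ?thesis
      using y n by (auto intro!: bern_abs_le eps)
  qed
  define K where "K = 2 * real n * \<epsilon> + 2 * D / sqrt (real n) * (1 + 4 / real n)"
  have K: "t * (1 - t) * \<bar>poly (deriv2 p) t\<bar> \<le> K" if "0 < t" "t < 1" for t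
    unfolding K_def using n by (intro weighted_deriv2 d3 that bern_err) auto
  have K0: "0 \<le> K" using n e0 by (simp add: K_def D_def)
  have "\<bar>second_diff (h * step_weight x) (poly p) x\<bar> \<le> 2 * K * h\<^sup>2"
    by (rule second_diff_poly_bound[OF K h(1) x xs])
  also have "\<dots> \<le> 2 * K * (1 / sqrt (real n))\<^sup>2"
    using h K0 by (intro mult_left_mono power_mono) auto
  also have "\<dots> = 4 * \<epsilon> + \<epsilon> * (24 * (sqrt 6 * (1 + 4 / real n)))"
    using n by (simp add: K_def D_def power_divide field_simps)
  \<comment> \<open>\<open>24 * 2.45 * 1.04\<close> is about \<open>61.2\<close>, hence
    \<open>66\<close> below; the second difference of \<open>f - p\<close> adds at most
    \<open>4 \<epsilon>\<close>.\<close>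
  also have "\<dots> \<le> 4 * \<epsilon> + \<epsilon> * (24 * ((245 / 100) * (1 + 4 / 100)))"
  proof (intro add_left_mono mult_left_mono mult_mono e0)
    show "sqrt 6 \<le> 245 / 100"
      by (rule real_le_lsqrt) (auto simp: power2_eq_square)
    show "4 / real n \<le> 4 / 100" using n by (intro divide_left_mono) auto
  qed auto
  also have "\<dots> \<le> 66 * \<epsilon>" using e0 by simp
  finally have "\<bar>second_diff (h * step_weight x) (poly p) x\<bar> \<le> 66 * \<epsilon>" .
  then show ?thesis
    using eps[OF x] eps[OF xs(1)] eps[OF xs(2)]
    unfolding second_diff_def \<epsilon>_def[symmetric] by linarith
qed

lemma DT_modulus_le:
  assumes "100 \<le> n" "continuous_on {0..1} f"
  shows "DT_modulus f (1 / sqrt (real n)) \<le> 70 * sup_norm (\<lambda>x. bernstein_op n f x - f x)"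
  unfolding DT_modulus_def
proof (rule cSup_least)
  have "0 \<le> (0::real) \<and> 0 \<le> 1 / sqrt (real n) \<and> 0 \<in> {0..1::real} \<and>
      0 + 0 * step_weight 0 \<in> {0..1} \<and> 0 - 0 * step_weight 0 \<in> {0..1}" by simp
  then show "{\<bar>second_diff (h * step_weight x) f x\<bar> |h x. 0 \<le> h \<and> h \<le> 1 / sqrt (real n) \<and> x \<in> {0..1} \<and>
      x + h * step_weight x \<in> {0..1} \<and> x - h * step_weight x \<in> {0..1}} \<noteq> {}" by blast
qed (use second_diff_le[OF assms] in blast)

lemma le_DT_modulus:
  assumes f: "continuous_on {0..1} f" and "0 \<le> h" "h \<le> \<delta>" "x \<in> {0..1}"
    "x + h * step_weight x \<in> {0..1}" "x - h * step_weight x \<in> {0..1}"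
  shows "\<bar>second_diff (h * step_weight x) f x\<bar> \<le> DT_modulus f \<delta>"
  unfolding DT_modulus_def
proof (rule cSup_upper)
  show "bdd_above {\<bar>second_diff (h * step_weight x) f x\<bar> |h x. 0 \<le> h \<and> h \<le> \<delta> \<and> x \<in> {0..1} \<and>
      x + h * step_weight x \<in> {0..1} \<and> x - h * step_weight x \<in> {0..1}}"
  proof (rule bdd_aboveI[of _ "4 * sup_norm f"], clarify)
    fix h x assume "x \<in> {0..1}" "x + h * step_weight x \<in> {0..1}" "x - h * step_weight x \<in> {0..1}"
    from this[THEN abs_le_sup_norm[OF f]]
    show "\<bar>second_diff (h * step_weight x) f x\<bar> \<le> 4 * sup_norm f"
      unfolding second_diff_def by linarith
  qed
qed (use assms in blast)

text \<open>At \<open>b = 0\<close> the first hypothesis forces \<open>a <= 0\<close>, and division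
  by zero in \<open>ereal\<close> then yields \<open>0\<close> or
  \<open>-\<infinity>\<close>.\<close>

lemma ereal_ratio_le:
  assumes "a \<le> C * b" "0 \<le> b" "0 \<le> C"
  shows "ereal a / ereal b \<le> ereal C"
proof (cases "b = 0")
  case True
  then have "a \<le> 0" using assms by simp
  then show ?thesis using True assms(3)
    by (cases "a = 0") (auto simp: divide_ereal_def)
next
  case False
  then show ?thesis using assms by (simp add: divide_simps)
qed

lemma ereal_ratio_ge:
  assumes "C \<le> a" "0 \<le> b" "b \<le> 1" "0 < C"
  shows "ereal C \<le> ereal a / ereal b"
proof (cases "b = 0")
  case True
  then show ?thesis using assms by (auto simp: divide_ereal_def)
next
  case False
  have "C * b \<le> C * 1" using assms by (intro mult_left_mono) auto
  then have "C * b \<le> a" using assms(1) by linarith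
  then show ?thesis using False assms by (simp add: pos_le_divide_eq)
qed

section \<open>The lower bound\<close>

text \<open>The oscillating part vanishes at the nodes \<open>k/n\<close>, so \<open>B\<^sub>n\<close> only sees \<open>4nx\<^sup>2\<close>, whose error is
  \<open>4x(1-x)\<close>; the error of the sum is \<open>4x(1-x) cos(2\<pi>nx)\<close>.\<close>

definition extremal :: "nat \<Rightarrow> real \<Rightarrow> real" where
  "extremal n x = 4 * real n * x\<^sup>2 + 4 * (x * (1 - x)) * (1 - cos (2 * pi * real n * x))"

lemma extremal_error:
  assumes "0 < n"
  shows "bernstein_op n (extremal n) x - extremal n x = 4 * (x * (1 - x)) * cos (2 * pi * real n * x)"
proof -
  have node: "extremal n (real k / real n) = 4 / real n * (real k)\<^sup>2" for k
  proof -
    have "2 * pi * real n * (real k / real n) = 2 * real k * pi"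
      using assms by simp
    then show ?thesis
      unfolding extremal_def using assms by (simp only: cos_2npi) (simp add: power2_eq_square)
  qed
  have "(\<lambda>i. (real i)\<^sup>2) = (\<lambda>i. (real i - real n * x)\<^sup>2 + ((2 * real n * x) * (real i - real n * x) ^ 1 + (real n * x)\<^sup>2))"
    by (simp add: power2_eq_square algebra_simps)
  then have "bern n (\<lambda>i. (real i)\<^sup>2) x = central_moment n 2 x + ((2 * real n * x) * central_moment n 1 x + (real n * x)\<^sup>2)"
    by (simp only: central_moment_def bern_add bern_cmult bern_const)
  then have sq: "bern n (\<lambda>i. (real i)\<^sup>2) x = real n * (x * (1 - x)) + (real n * x)\<^sup>2"
    by (simp only: central_moment_1 central_moment_2)
  have "bernstein_op n (extremal n) x = 4 / real n * bern n (\<lambda>i. (real i)\<^sup>2) x"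
    unfolding bernstein_op_eq_poly poly_bpoly node bern_cmult ..
  also have "\<dots> = 4 * (x * (1 - x)) + 4 * real n * x\<^sup>2"
    unfolding sq using assms by (simp add: field_simps power2_eq_square)
  finally show ?thesis by (simp add: extremal_def algebra_simps)
qed

lemma continuous_on_extremal: "continuous_on A (extremal n)"
  unfolding extremal_def by (intro continuous_intros)

lemma sup_norm_extremal_error:
  assumes "0 < n"
  shows "sup_norm (\<lambda>x. bernstein_op n (extremal n) x - extremal n x) \<le> 1"
proof (rule sup_norm_le)
  fix x :: real assume x: "x \<in> {0..1}"
  have "0 \<le> (2 * x - 1)\<^sup>2" by simp
  then have "4 * (x * (1 - x)) \<le> 1" by (simp add: power2_eq_square algebra_simps)
  moreover have "0 \<le> 4 * (x * (1 - x))" using x by simp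
  ultimately have "\<bar>4 * (x * (1 - x))\<bar> * \<bar>cos (2 * pi * real n * x)\<bar> \<le> 1 * 1"
    by (intro mult_mono) auto
  then show "\<bar>bernstein_op n (extremal n) x - extremal n x\<bar> \<le> 1"
    by (simp add: extremal_error[OF assms] abs_mult)
qed

text \<open>For \<open>n = 4 m^2\<close> the midpoint is a node, where the cosine is
  \<open>1\<close>, and steps up to \<open>1/(4 m)\<close> are admissible there. Of these,
  \<open>s\<close> is the largest with \<open>n s\<close> half an odd integer, which makes both
  outer cosines \<open>-1\<close>. The oscillation gives about \<open>4\<close>, the quadratic term
  about \<open>2\<close>.\<close>

lemma second_diff_extremal:
  assumes "3 \<le> m"
  defines "s \<equiv> (2 * real m - 1) / (8 * (real m)\<^sup>2)"
  shows "5 \<le> second_diff s (extremal (4 * m\<^sup>2)) (1 / 2)"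
proof -
  have m: "0 < m" using assms(1) by simp
  define N where "N = real (4 * m\<^sup>2)"
  have N: "N = 4 * (real m)\<^sup>2" by (simp add: N_def)
  have Ns: "N * s = real m - 1 / 2"
    using m by (simp add: N s_def field_simps power2_eq_square)
  have c0: "cos (2 * pi * N * (1 / 2)) = 1"
    using cos_2npi[of "2 * m\<^sup>2"] by (simp add: N mult_ac)
  have cm: "cos (2 * pi * N * (1 / 2 + s)) = - 1" "cos (2 * pi * N * (1 / 2 - s)) = - 1"
  proof -
    have "2 * pi * N * (1 / 2 + s) = 2 * pi * N * (1 / 2) + 2 * pi * (N * s)"
      "2 * pi * N * (1 / 2 - s) = 2 * pi * N * (1 / 2) - 2 * pi * (N * s)"
      by (simp_all add: algebra_simps)
    moreover have "2 * pi * (N * s) = 2 * pi * real m - pi"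
      unfolding Ns by (simp add: algebra_simps)
    moreover have "2 * pi * N * (1 / 2) = 2 * real (2 * m\<^sup>2) * pi"
      by (simp add: N)
    moreover have "sin (2 * pi * N * (1 / 2)) = 0"
      unfolding \<open>2 * pi * N * (1 / 2) = 2 * real (2 * m\<^sup>2) * pi\<close> by (metis mult.commute mult.left_commute sin_2npi)
    moreover have "cos (2 * pi * real m - pi) = - 1"
      using cos_2npi[of m] by (simp add: cos_diff mult_ac)
    ultimately show "cos (2 * pi * N * (1 / 2 + s)) = - 1" "cos (2 * pi * N * (1 / 2 - s)) = - 1"
      using c0 by (simp_all only: cos_add cos_diff)
  qed
  have "second_diff s (extremal (4 * m\<^sup>2)) (1 / 2) = 4 + (8 * N - 16) * s\<^sup>2"
    unfolding second_diff_def extremal_def N_def[symmetric] c0 cm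
    by (simp add: power2_eq_square algebra_simps)
  moreover have "1 \<le> (8 * N - 16) * s\<^sup>2"
  proof -
    \<comment> \<open>\<open>m >= 3\<close> gives \<open>2 m^2 - 1 >= 17/9 m^2\<close> and
      \<open>2 m - 1 >= 5/3 m\<close>, and \<open>17/9 * 25/9 > 4\<close>.\<close>
    have m3: "3 \<le> real m" using assms(1) by simp
    have "3 * 3 \<le> real m * real m" using m3 by (intro mult_mono) auto
    then have "17 / 9 * (real m)\<^sup>2 \<le> 2 * (real m)\<^sup>2 - 1" by (simp add: power2_eq_square)
    moreover have "(5 / 3 * real m)\<^sup>2 \<le> (2 * real m - 1)\<^sup>2"
      using m3 by (intro power_mono) auto
    ultimately have "17 / 9 * (real m)\<^sup>2 * (5 / 3 * real m)\<^sup>2 \<le> (2 * (real m)\<^sup>2 - 1) * (2 * real m - 1)\<^sup>2"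
      by (intro mult_mono) (auto simp: order_trans[OF _ \<open>17 / 9 * (real m)\<^sup>2 \<le> 2 * (real m)\<^sup>2 - 1\<close>])
    moreover have "4 * (real m)\<^sup>2 * (real m)\<^sup>2 \<le> 17 / 9 * (real m)\<^sup>2 * (5 / 3 * real m)\<^sup>2"
      by (simp add: power2_eq_square)
    ultimately have "4 * (real m)\<^sup>2 * (real m)\<^sup>2 \<le> (2 * (real m)\<^sup>2 - 1) * (2 * real m - 1)\<^sup>2" by linarith
    moreover have "(8 * N - 16) * s\<^sup>2 = ((2 * (real m)\<^sup>2 - 1) * (2 * real m - 1)\<^sup>2) / (4 * (real m)\<^sup>2 * (real m)\<^sup>2)"
    proof -
      have "(8 * (4 * q) - 16) * (t / (8 * q))\<^sup>2 = ((2 * q - 1) * t\<^sup>2) / (4 * q * q)" if "0 < q" for q t :: real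
        using that by (simp add: field_simps power2_eq_square)
      then show ?thesis
        unfolding N s_def using m by simp
    qed
    ultimately show ?thesis using m by (simp add: le_divide_eq_1_pos)
  qed
  ultimately show ?thesis by simp
qed

lemma affine_second_diff:
  assumes "affine_on_unit f" "x \<in> {0..1}" "x + s \<in> {0..1}" "x - s \<in> {0..1}"
  shows "second_diff s f x = 0"
proof -
  from assms(1) obtain a b where "\<And>x. x \<in> {0..1} \<Longrightarrow> f x = a * x + b"
    unfolding affine_on_unit_def by blast
  then show ?thesis using assms(2-) by (simp add: second_diff_def algebra_simps)
qed

lemma extremal_ratio:
  assumes "3 \<le> m"
  defines "n \<equiv> 4 * m\<^sup>2"
  shows "extremal n \<in> nonaffine_functions" "5 \<le> DT_modulus (extremal n) (1 / sqrt (real n))"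
proof -
  define s where "s = (2 * real m - 1) / (8 * (real m)\<^sup>2)"
  \<comment> \<open>Since \<open>step_weight (1/2) = 1/2\<close>, this \<open>h\<close> yields the
    step \<open>s\<close>.\<close>
  define h where "h = 2 * s"
  have m: "3 \<le> real m" using assms(1) by simp
  have s0: "0 \<le> s" using m by (simp add: s_def)
  have sq: "sqrt (real n) = 2 * real m"
    by (simp add: n_def real_sqrt_mult)
  have "s \<le> (2 * real m) / (8 * (real m)\<^sup>2)"
    unfolding s_def by (intro divide_right_mono) auto
  also have "\<dots> = 1 / sqrt (real n) / 2"
    using m by (simp add: sq power2_eq_square)
  finally have hle: "h \<le> 1 / sqrt (real n)" by (simp add: h_def)
  also have "\<dots> \<le> 1" using m by (simp add: sq)
  finally have s1: "s \<le> 1 / 2" by (simp add: h_def)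
  have "step_weight (1 / 2) = sqrt ((1 / 2)\<^sup>2)"
    unfolding step_weight_def by (rule arg_cong[of _ _ sqrt]) (simp add: power2_eq_square)
  then have hs: "h * step_weight (1 / 2) = s"
    by (simp add: h_def)
  have sd: "5 \<le> second_diff s (extremal n) (1 / 2)"
    using second_diff_extremal[OF assms(1)] by (simp add: n_def s_def)
  have "\<bar>second_diff s (extremal n) (1 / 2)\<bar> \<le> DT_modulus (extremal n) (1 / sqrt (real n))"
    using le_DT_modulus[OF continuous_on_extremal, of h "1 / sqrt (real n)" "1 / 2" n] s0 s1 hle
    by (simp only: hs) (simp add: h_def)
  then show "5 \<le> DT_modulus (extremal n) (1 / sqrt (real n))" using sd by linarith
  have "\<not> affine_on_unit (extremal n)"
    using affine_second_diff[of "extremal n" "1 / 2" s] sd s0 s1 by auto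
  then show "extremal n \<in> nonaffine_functions"
    by (simp add: nonaffine_functions_def continuous_on_extremal)
qed

theorem theorem1:
  shows "5 \<le> limsup (\<lambda>n. SUP f\<in>nonaffine_functions.
             ereal (DT_modulus f (1 / sqrt (real n))) / ereal (sup_norm (\<lambda>x. bernstein_op n f x - f x)))
       \<and> limsup (\<lambda>n. SUP f\<in>nonaffine_functions.
             ereal (DT_modulus f (1 / sqrt (real n))) / ereal (sup_norm (\<lambda>x. bernstein_op n f x - f x))) < 75"
    (is "5 \<le> limsup ?R \<and> limsup ?R < 75")
proof
  have nonneg: "0 \<le> sup_norm (\<lambda>x. bernstein_op n f x - f x)" if "continuous_on {0..1} f" for n f
    using abs_le_sup_norm[OF continuous_on_bernstein_error[OF that], of 0 n] by (auto intro: order_trans[OF abs_ge_zero])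
  have "5 \<le> ?R (4 * m\<^sup>2)" if m: "3 \<le> m" for m
  proof -
    let ?n = "4 * m\<^sup>2"
    have "ereal 5 \<le> ereal (DT_modulus (extremal ?n) (1 / sqrt (real ?n))) /
        ereal (sup_norm (\<lambda>x. bernstein_op ?n (extremal ?n) x - extremal ?n x))"
      using m by (intro ereal_ratio_ge extremal_ratio nonneg continuous_on_extremal sup_norm_extremal_error) auto
    also have "\<dots> \<le> ?R ?n"
      by (rule SUP_upper) (rule extremal_ratio(1)[OF m])
    finally show ?thesis by simp
  qed
  \<comment> \<open>The lower bound holds along \<open>n = 4 m^2\<close>, and the limsup of a
    subsequence is at most that of the whole sequence.\<close>
  then have "5 \<le> limsup (?R \<circ> (\<lambda>m. 4 * m\<^sup>2))"
    by (intro le_Limsup) (auto simp: eventually_sequentially intro!: exI[of _ 3])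
  also have "\<dots> \<le> limsup ?R"
    by (rule limsup_subseq_mono) (simp add: strict_mono_def power_strict_mono)
  finally show "5 \<le> limsup ?R" .
  have "?R n \<le> 70" if n: "100 \<le> n" for n
  proof (rule SUP_least)
    fix f assume "f \<in> nonaffine_functions"
    then have f: "continuous_on {0..1} f" by (simp add: nonaffine_functions_def)
    show "ereal (DT_modulus f (1 / sqrt (real n))) / ereal (sup_norm (\<lambda>x. bernstein_op n f x - f x)) \<le> 70"
      using ereal_ratio_le[OF DT_modulus_le[OF n f] nonneg[OF f]] by simp
  qed
  then have "limsup ?R \<le> 70"
    by (intro Limsup_bounded) (auto simp: eventually_sequentially intro!: exI[of _ 100])
  also have "\<dots> < 75" by simp
  finally show "limsup ?R < 75" .
qed

end
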